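(* Let $r\ge2$ be an integer, assume $0<p<1/r$, and set, for $d\ge0$, $$\nu_d:=\frac{d}{\log_r(1/p)-1}.$$ Then, with probability one, $$\frac{R_d}{d}\longrightarrow\frac{1}{\log_r(1/p)-1},\qquad d\to\infty.$$ Moreover, the sequence of random variables $(R_d-\nu_d:d\ge0)$ is tight. In addition, a subsequence of $R_d-\nu_d$ converges weakly if, and only if, the limit $a:=\lim_{d\to\infty}(\nu_d-[\nu_d])$, taken along that subsequence, exists, in which case the weak limit is $[Z+a]-a$, where $$\mathbb{P}(Z\le z)=\exp\left(-C\,(rp)^{z}\right),\qquad z\in\mathbb{R},$$ for an explicit constant $C>0$ depending only on $(p,r)$.
   Context: Let $\mathbb{T}$ be the infinite $r$-ary tree rooted at $\rho_0$ (every node has exactly $r$ children). To each node $v\in\mathbb{T}$ is attached a random variable $X_v$, where the family $\{X_v:v\in\mathbb{T}\}$ is i.i.d. Bernoulli with $\mathbb{P}(X_v=1)=1-\mathbb{P}(X_v=0)=p\in(0,1)$. A subset $A\subset\mathbb{T}$ is open if $X_v=1$ for all $v\in A$. The generation $\mathrm{gen}(v)$ is the graph distance from $\rho_0$ to $v$ (so $\mathrm{gen}(\rho_0)=0$), and $\mathbb{T}_d=\{v\in\mathbb{T}:\mathrm{gen}(v)\le d\}$. A run is a path in $\mathbb{T}$ directed away from the root $\rho_0$, i.e. a sequence of nodes in which each node after the first is a child of the previous one; its length $|A|$ is its number of nodes and its root $\rho(A)$ is its node of minimal generation. For $d\in\mathbb{N}$ (including $d=0$), $R_d$ is the length of the longest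 open run whose root has generation at most $d$: $$R_d=\max\{|A|: A\text{ an open run with }\rho(A)\in\mathbb{T}_d\}$$ (equal to $0$ if there is no such run). $\log_r$ denotes the logarithm in base $r$, and $[x]$ denotes the integer part of $x\in\mathbb{R}$.
   Formalization: The limit a of ν_d−[ν_d] is taken modulo 1 (0 and 1 identified), as the literal "only if" fails when fractional parts alternate near 0 and 1; C, given no formula, is shown to exist for each sample-space type, and is the same for all since the law of R_d depends only on (p,r). *)

theory Defs
  imports "HOL-Probability.Probability"
begin

(* A node of the infinite r-ary tree is the word over {0..<r} that spells the path leading to it
   from the root; the root is the empty word. *)

definition tree_nodes :: "nat \<Rightarrow> nat list set" where
  "tree_nodes r = lists {..<r}"

definition is_child :: "nat \<Rightarrow> nat list \<Rightarrow> nat list \<Rightarrow> bool" where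
  "is_child r v w \<longleftrightarrow> (\<exists>i<r. w = v @ [i])"

definition gen :: "nat list \<Rightarrow> nat" where
  "gen v = length v"

(* The node of minimal generation of a run A is its first node, hd A. *)
definition is_run :: "nat \<Rightarrow> nat list list \<Rightarrow> bool" where
  "is_run r A \<longleftrightarrow> A \<noteq> [] \<and> set A \<subseteq> tree_nodes r \<and> successively (is_child r) A"

definition open_run_lengths :: "nat \<Rightarrow> (nat list \<Rightarrow> bool) \<Rightarrow> nat \<Rightarrow> nat set" where
  "open_run_lengths r x d = {length A |A. is_run r A \<and> (\<forall>v\<in>set A. x v) \<and> gen (hd A) \<le> d}"

(* If there are open runs of unbounded length (for p < 1/r an event of probability 0) the maximum
   does not exist and the value is set to 0. This hides nothing in an almost sure limit theorem for
   longest_open_run r x d / d with positive limit: the sets open_run_lengths r x d increase with d,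
   so a configuration for which one of them is infinite has value 0 for all large d. *)
definition longest_open_run :: "nat \<Rightarrow> (nat list \<Rightarrow> bool) \<Rightarrow> nat \<Rightarrow> nat" where
  "longest_open_run r x d =
     (if finite (open_run_lengths r x d) then Max (insert 0 (open_run_lengths r x d)) else 0)"

(* X v = True stands for X_v = 1. *)
definition iid_bernoulli :: "'a measure \<Rightarrow> nat \<Rightarrow> real \<Rightarrow> (nat list \<Rightarrow> 'a \<Rightarrow> bool) \<Rightarrow> bool" where
  "iid_bernoulli M r p X \<longleftrightarrow>
     prob_space M \<and>
     prob_space.indep_vars M (\<lambda>_. count_space UNIV) X (tree_nodes r) \<and>
     (\<forall>v\<in>tree_nodes r. distr M (count_space UNIV) (X v) = measure_pmf (bernoulli_pmf p))"

definition R :: "nat \<Rightarrow> (nat list \<Rightarrow> 'a \<Rightarrow> bool) \<Rightarrow> nat \<Rightarrow> 'a \<Rightarrow> nat" where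
  "R r X d \<omega> = longest_open_run r (\<lambda>v. X v \<omega>) d"

definition \<nu> :: "nat \<Rightarrow> real \<Rightarrow> nat \<Rightarrow> real" where
  "\<nu> r p d = real d / (log (real r) (1 / p) - 1)"

definition centred_law ::
    "'a measure \<Rightarrow> nat \<Rightarrow> real \<Rightarrow> (nat list \<Rightarrow> 'a \<Rightarrow> bool) \<Rightarrow> nat \<Rightarrow> real measure" where
  "centred_law M r p X d = distr M borel (\<lambda>\<omega>. real (R r X d \<omega>) - \<nu> r p d)"

definition converges_weakly :: "(nat \<Rightarrow> real measure) \<Rightarrow> bool" where
  "converges_weakly \<mu> \<longleftrightarrow> (\<exists>L. real_distribution L \<and> weak_conv_m \<mu> L)"

(* Convergence in the circle \<real>/\<int>. Fractional parts have to be compared there: the laws of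
   \<lfloor>Z + 0\<rfloor> - 0 and \<lfloor>Z + 1\<rfloor> - 1 coincide, so along a subsequence for which the fractional part of
   \<nu> r p d is alternately close to 0 and close to 1 the centred laws still converge weakly, although
   the fractional parts have no limit in \<real>. Such subsequences exist whenever \<nu> r p 1 is
   irrational. The lemmas below relate this notion to convergence in \<real>. *)
definition tends_mod1 :: "(nat \<Rightarrow> real) \<Rightarrow> real \<Rightarrow> bool" where
  "tends_mod1 x a \<longleftrightarrow> (\<exists>m::nat \<Rightarrow> int. (\<lambda>k. x k - of_int (m k)) \<longlonglongrightarrow> a)"

lemma tends_mod1_LIMSEQ: "x \<longlonglongrightarrow> a \<Longrightarrow> tends_mod1 x a"
  unfolding tends_mod1_def by (rule exI[of _ "\<lambda>_. 0"]) simp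

lemma tends_mod1_frac_LIMSEQ:
  assumes "tends_mod1 (\<lambda>k. frac (x k)) a" and "a \<notin> \<int>"
  shows "(\<lambda>k. frac (x k)) \<longlonglongrightarrow> frac a"
proof -
  obtain m :: "nat \<Rightarrow> int" where m: "(\<lambda>k. frac (x k) - of_int (m k)) \<longlonglongrightarrow> a"
    using assms(1) unfolding tends_mod1_def by blast
  have "\<forall>\<^sub>F k in sequentially. \<lfloor>frac (x k) - of_int (m k)\<rfloor> = \<lfloor>a\<rfloor>"
    using eventually_floor_eq[OF m assms(2)] .
  then have "\<forall>\<^sub>F k in sequentially. frac (x k) - of_int (m k) - of_int \<lfloor>a\<rfloor> = frac (x k)"
  proof eventually_elim
    case (elim k)
    have "\<lfloor>frac (x k)\<rfloor> - m k = \<lfloor>a\<rfloor>" using elim by simp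
    moreover have "\<lfloor>frac (x k)\<rfloor> = 0" by (simp add: floor_eq_iff frac_lt_1)
    ultimately show ?case by simp
  qed
  moreover have "(\<lambda>k. frac (x k) - of_int (m k) - of_int \<lfloor>a\<rfloor>) \<longlonglongrightarrow> frac a"
    unfolding frac_def[of a] by (intro tendsto_intros m)
  ultimately show ?thesis by (rule Lim_transform_eventually[rotated])
qed

lemma tends_mod1_frac_iff_convergent:
  assumes "e > 0" and "\<And>k. frac (x k) \<le> 1 - e"
  shows "(\<exists>a. tends_mod1 (\<lambda>k. frac (x k)) a) \<longleftrightarrow> convergent (\<lambda>k. frac (x k))"
proof
  assume "\<exists>a. tends_mod1 (\<lambda>k. frac (x k)) a"
  then obtain a where a: "tends_mod1 (\<lambda>k. frac (x k)) a" ..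
  show "convergent (\<lambda>k. frac (x k))"
  proof (cases "a \<in> \<int>")
    case False
    then show ?thesis using tends_mod1_frac_LIMSEQ[OF a] by (auto simp: convergent_def)
  next
    case True
    then obtain j :: int where j: "a = of_int j" by (elim Ints_cases)
    obtain m :: "nat \<Rightarrow> int" where m: "(\<lambda>k. frac (x k) - of_int (m k)) \<longlonglongrightarrow> a"
      using a unfolding tends_mod1_def by blast
    have "(\<lambda>k. frac (x k) - of_int (m k) - of_int j) \<longlonglongrightarrow> 0"
      using tendsto_diff[OF m tendsto_const[of "of_int j"]] by (simp add: j)
    then have lim: "(\<lambda>k. frac (x k) - of_int (m k + j)) \<longlonglongrightarrow> 0"
      by (simp add: algebra_simps)
    have "\<forall>\<^sub>F k in sequentially. \<bar>frac (x k) - of_int (m k + j)\<bar> < min e 1"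
      using tendstoD[OF lim, of "min e 1"] assms(1) by (simp add: dist_real_def)
    then have "\<forall>\<^sub>F k in sequentially. frac (x k) - of_int (m k + j) = frac (x k)"
    proof eventually_elim
      case (elim k)
      have "of_int (m k + j) < (1::real)" "of_int (m k + j) > (-1::real)"
        using elim assms(2)[of k] frac_ge_0[of "x k"] by linarith+
      then have "m k + j < 1" "m k + j > -1" by linarith+
      then show ?case by simp
    qed
    then have "(\<lambda>k. frac (x k)) \<longlonglongrightarrow> 0"
      by (rule Lim_transform_eventually[OF lim])
    then show ?thesis by (auto simp: convergent_def)
  qed
qed (auto simp: convergent_def intro: tends_mod1_LIMSEQ)

end

theory Submission
  imports Defs
begin

text \<open>Let \<open>h n\<close> be the probability that an open run of length \<open>n\<close> starts at a given node, and let
  \<open>u n d\<close> be the probability that \<open>R d < n\<close>. Since \<open>rp < 1\<close>, the recursion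
  \<open>h (n + 1) = p (1 - (1 - h n)^r)\<close> gives \<open>h n / (rp)^n \<longlonglongrightarrow> c > 0\<close>.

  If no run of length \<open>n\<close> starts at a descendant of the root, then the longest run starting at the
  root has length at most \<open>n\<close>; it has length exactly \<open>n\<close> with unconditional probability
  \<open>\<delta> n = h n - h (n + 1)\<close>. Hence \<open>u n d ^ r - \<delta> n \<le> u n (d + 1) \<le> u n d ^ r (1 - \<delta> n)\<close>, where the upper
  bound expresses a correlation inequality that follows by induction from the recursion for the joint
  law of \<open>R d\<close> and the run length at the root. Iterating both bounds from \<open>u n 0 = 1 - h n\<close> shows that
  \<open>u n d\<close> is asymptotically the exponential of minus
  \<open>r^d h n + (r^d - 1) / (r - 1) \<delta> n\<close>, which for \<open>n = \<nu> d + z\<close> tends to \<open>C (rp)^z\<close>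
  with \<open>C = c (1 - p) r / (r - 1)\<close>. Tightness and, with the Borel-Cantelli lemma, the almost
  sure convergence follow from the same bounds. A limit law along a subsequence determines \<open>a\<close>
  modulo 1, because the atoms of \<open>\<lfloor>Z + a\<rfloor> - a\<close> are the points of \<open>\<int> - a\<close>.\<close>

section \<open>The recursion for the distribution functions\<close>

text \<open>Both factors in \<open>a ^ Suc k - b ^ Suc k = a * (a ^ k - b ^ k) + b ^ k * (a -
  b)\<close> can only grow from the primed to the unprimed pair. This carries comparisons of
  increments through the \<open>r\<close>-th powers of the recursions.\<close>

lemma power_diff_mono_increments:
  fixes a b a' b' :: real
  assumes "0 \<le> b'" "b' \<le> b" "b' \<le> a'" "a' - b' \<le> a - b"
  shows "a' ^ k - b' ^ k \<le> a ^ k - b ^ k"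
proof (induction k)
  case (Suc k)
  have "a' * (a' ^ k - b' ^ k) \<le> a * (a ^ k - b ^ k)"
    using assms Suc by (intro mult_mono) (auto simp: power_mono)
  moreover have "b' ^ k * (a' - b') \<le> b ^ k * (a - b)"
    using assms by (intro mult_mono power_mono) auto
  ultimately show ?case by (simp add: algebra_simps)
qed simp

text \<open>The \<open>k\<close>-th power is \<open>k\<close>-Lipschitz on the unit interval. This
  controls how an additive error grows under the recursion.\<close>

lemma power_ge_power_minus:
  fixes a b t :: real
  assumes "0 \<le> a" "a \<le> 1" "0 \<le> b" "a - t \<le> b" "0 \<le> t"
  shows "a ^ k - real k * t \<le> b ^ k"
proof (induction k)
  case (Suc k)
  show ?case
  proof (cases "a \<le> b")
    case True
    have "a ^ Suc k \<le> b ^ Suc k" using True assms by (intro power_mono) auto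
    moreover have "0 \<le> real (Suc k) * t" using assms by simp
    ultimately show ?thesis by linarith
  next
    case False
    have "b * (a ^ k - real k * t) \<le> b * b ^ k"
      using assms Suc by (intro mult_left_mono) auto
    moreover have "a ^ k * (a - b) \<le> 1 * t"
      using assms False by (intro mult_mono) (auto simp: power_le_one)
    moreover have "b * (real k * t) \<le> 1 * (real k * t)"
      using assms False by (intro mult_right_mono) auto
    ultimately show ?thesis by (simp add: algebra_simps)
  qed
qed simp

text \<open>Bernoulli's inequality for \<open>(1 + h) ^ k\<close> bounds
  \<open>(1 - h) ^ k * (1 + real k * h)\<close> by \<open>(1 - h\<^sup>2) ^ k\<close>. This form is
  suited to taking reciprocals.\<close>

lemma one_minus_power_ge:
  fixes h :: real
  assumes "0 \<le> h" "h \<le> 1"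
  shows "real k * h / (1 + real k * h) \<le> 1 - (1 - h) ^ k"
proof -
  have pos: "0 < 1 + real k * h" using assms by (simp add: add_pos_nonneg)
  have "(1 - h) ^ k * (1 + real k * h) \<le> (1 - h) ^ k * (1 + h) ^ k"
    using assms Bernoulli_inequality[of h k] by (intro mult_left_mono) auto
  also have "\<dots> = (1 - h\<^sup>2) ^ k"
    by (simp flip: power_mult_distrib add: algebra_simps power2_eq_square)
  also have "\<dots> \<le> 1" using assms by (intro power_le_one) (auto simp: power_le_one)
  finally show ?thesis using pos by (simp add: field_simps)
qed

section \<open>The run length at a single node and its geometric decay\<close>

locale subcritical =
  fixes r :: nat and p :: real
  assumes r_ge_2: "2 \<le> r" and p_pos: "0 < p" and p_less: "p < 1 / real r"
begin

definition \<beta> :: real where "\<beta> = real r * p"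

lemma \<beta>_pos: "0 < \<beta>" and \<beta>_less_1: "\<beta> < 1" and p_less_1: "p < 1"
proof -
  show "0 < \<beta>" using r_ge_2 p_pos by (simp add: \<beta>_def)
  show "\<beta> < 1" using r_ge_2 p_less by (simp add: \<beta>_def field_simps)
  have "1 / real r \<le> 1" using r_ge_2 by simp
  then show "p < 1" using p_less by linarith
qed

text \<open>The probability that the longest open run starting at a given node has length less than
  \<open>n\<close>, the empty run counting as a run of length 0.\<close>

primrec short :: "nat \<Rightarrow> real" where
  "short 0 = 0"
| "short (Suc n) = 1 - p + p * short n ^ r"

lemma short_bounds: "0 \<le> short n \<and> short n \<le> 1"
proof (induction n)
  case (Suc n)
  then have "0 \<le> short n ^ r" "short n ^ r \<le> 1" by (auto simp: power_le_one)
  then have "0 \<le> p * short n ^ r" "p * short n ^ r \<le> p" using p_pos by auto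
  then show ?case using p_less_1 by simp
qed simp

lemmas short_nonneg = short_bounds[THEN conjunct1]
lemmas short_le_1 = short_bounds[THEN conjunct2]

lemma short_mono_Suc: "short n \<le> short (Suc n)"
proof (induction n)
  case 0
  then show ?case using short_nonneg[of 1] by simp
next
  case (Suc n)
  then have "p * short n ^ r \<le> p * short (Suc n) ^ r"
    using p_pos short_nonneg by (intro mult_left_mono power_mono) auto
  then show ?case by simp
qed

text \<open>The probability \<open>h n\<close> of the introductory outline.\<close>

definition long :: "nat \<Rightarrow> real" where "long n = 1 - short n"

definition \<delta> :: "nat \<Rightarrow> real" where "\<delta> n = short (Suc n) - short n"

lemma \<delta>_Suc: "\<delta> (Suc k) = p * (short (Suc k) ^ r - short k ^ r)"
  by (simp add: \<delta>_def algebra_simps)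

lemma \<delta>_nonneg: "0 \<le> \<delta> n" using short_mono_Suc[of n] by (simp add: \<delta>_def)
lemma \<delta>_eq: "\<delta> n = long n - long (Suc n)" by (simp add: \<delta>_def long_def)
lemma long_nonneg: "0 \<le> long n" using short_le_1[of n] by (simp add: long_def)
lemma long_le_1: "long n \<le> 1" using short_nonneg[of n] by (simp add: long_def)
lemma \<delta>_le_long: "\<delta> n \<le> long n" using long_nonneg[of "Suc n"] by (simp add: \<delta>_eq)

lemma long_Suc: "long (Suc n) = p * (1 - (1 - long n) ^ r)"
  by (simp add: long_def algebra_simps)

lemma long_pos: "0 < long n"
proof (induction n)
  case 0
  then show ?case by (simp add: long_def)
next
  case (Suc n)
  have "(1 - long n) ^ r < 1"
    using Suc long_le_1[of n] r_ge_2 by (intro power_less_one_iff[THEN iffD2]) auto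
  then show ?case using p_pos by (simp add: long_Suc)
qed

lemma long_Suc_le: "long (Suc n) \<le> \<beta> * long n"
proof -
  have "1 - real r * long n \<le> (1 - long n) ^ r"
    using Bernoulli_inequality[of "- long n" r] long_le_1[of n] by simp
  then have "p * (1 - (1 - long n) ^ r) \<le> p * (real r * long n)"
    using p_pos by (intro mult_left_mono) auto
  then show ?thesis by (simp add: long_Suc \<beta>_def mult_ac)
qed

lemma long_le_power: "long n \<le> \<beta> ^ n"
proof (induction n)
  case (Suc n)
  have "\<beta> * long n \<le> \<beta> * \<beta> ^ n" using Suc \<beta>_pos by (intro mult_left_mono) auto
  then show ?case using long_Suc_le[of n] by simp
qed (simp add: long_def)

text \<open>Taking reciprocals in
  \<open>long (Suc n) \<ge> \<beta> * long n / (1 + r * long n)\<close> turns the correction factor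
  into the additive error \<open>r * \<beta> ^ n\<close>. These errors are summable, which keeps
  \<open>long n / \<beta> ^ n\<close> away from 0.\<close>

lemma inverse_long_Suc_le: "\<beta> ^ Suc n / long (Suc n) \<le> \<beta> ^ n / long n + real r * \<beta> ^ n"
proof -
  have "real r * long n / (1 + real r * long n) \<le> 1 - (1 - long n) ^ r"
    using long_nonneg long_le_1 by (rule one_minus_power_ge)
  then have "p * (real r * long n / (1 + real r * long n)) \<le> long (Suc n)"
    unfolding long_Suc using p_pos by (intro mult_left_mono) auto
  moreover have pos: "0 < 1 + real r * long n" using long_nonneg[of n] by (simp add: add_pos_nonneg)
  ultimately have "\<beta> * long n \<le> long (Suc n) * (1 + real r * long n)"
    by (simp add: \<beta>_def field_simps)
  then have "\<beta> ^ n * (\<beta> * long n) \<le> \<beta> ^ n * (long (Suc n) * (1 + real r * long n))"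
    using \<beta>_pos by (intro mult_left_mono) auto
  then show ?thesis
    using long_pos[of n] long_pos[of "Suc n"] by (simp add: divide_simps) (simp add: algebra_simps)
qed

lemma inverse_long_le: "\<beta> ^ n / long n \<le> 1 + real r / (1 - \<beta>)"
proof -
  have "\<beta> ^ n / long n \<le> 1 + real r * (\<Sum>i<n. \<beta> ^ i)"
  proof (induction n)
    case (Suc n)
    then show ?case using inverse_long_Suc_le[of n] by (simp add: algebra_simps)
  qed (simp add: long_def)
  also have "(\<Sum>i<n. \<beta> ^ i) \<le> (\<Sum>i. \<beta> ^ i)"
    using \<beta>_pos \<beta>_less_1 by (intro sum_le_suminf summable_geometric) auto
  also have "\<dots> = 1 / (1 - \<beta>)" using \<beta>_pos \<beta>_less_1 by (intro suminf_geometric) auto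
  finally show ?thesis using r_ge_2 by simp
qed

definition ratio :: "nat \<Rightarrow> real" where "ratio n = long n / \<beta> ^ n"

lemma decseq_ratio: "decseq ratio"
proof (rule decseq_SucI)
  fix n
  have "long (Suc n) / \<beta> ^ Suc n \<le> \<beta> * long n / \<beta> ^ Suc n"
    using long_Suc_le[of n] \<beta>_pos by (intro divide_right_mono) auto
  then show "ratio (Suc n) \<le> ratio n" using \<beta>_pos by (simp add: ratio_def)
qed

lemma ratio_ge: "1 / (1 + real r / (1 - \<beta>)) \<le> ratio n"
proof -
  have "1 / (1 + real r / (1 - \<beta>)) \<le> 1 / (\<beta> ^ n / long n)"
    using inverse_long_le[of n] \<beta>_pos long_pos[of n] \<beta>_less_1
    by (intro divide_left_mono mult_pos_pos divide_pos_pos add_pos_nonneg) auto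
  then show ?thesis by (simp add: ratio_def)
qed

definition c :: real where "c = lim ratio"

lemma ratio_tendsto: "ratio \<longlonglongrightarrow> c"
proof -
  have "\<exists>L. ratio \<longlonglongrightarrow> L \<and> (\<forall>i. L \<le> ratio i)"
    using decseq_convergent[OF decseq_ratio, of "1 / (1 + real r / (1 - \<beta>))"] ratio_ge by metis
  then show ?thesis unfolding c_def using limI by blast
qed

lemma c_pos: "0 < c"
proof -
  have "1 / (1 + real r / (1 - \<beta>)) \<le> c"
    using ratio_tendsto ratio_ge by (intro LIMSEQ_le_const[OF ratio_tendsto]) auto
  moreover have "0 < 1 / (1 + real r / (1 - \<beta>))"
    using \<beta>_less_1 by (auto intro!: add_pos_nonneg divide_pos_pos)
  ultimately show ?thesis by linarith
qed

lemma long_ge_power: "c * \<beta> ^ n \<le> long n"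
proof -
  have "c \<le> ratio n" using decseq_ge[OF decseq_ratio ratio_tendsto] .
  then show ?thesis using \<beta>_pos by (simp add: ratio_def field_simps)
qed

text \<open>\<open>avoid n d j\<close> is the probability that no open run of length \<open>n\<close> starts within the first
  \<open>d\<close> generations below a given node and no open run of length \<open>j\<close> starts at the node
  itself. This reading is limited to \<open>j \<le> n\<close>, but the estimates below hold for all \<open>j\<close>.\<close>

fun avoid :: "nat \<Rightarrow> nat \<Rightarrow> nat \<Rightarrow> real" where
  "avoid n 0 j = short j"
| "avoid n (Suc d) 0 = 0"
| "avoid n (Suc d) (Suc j) = (1 - p) * avoid n d n ^ r + p * avoid n d j ^ r"

abbreviation u :: "nat \<Rightarrow> nat \<Rightarrow> real" where "u n d \<equiv> avoid n d n"

lemma avoid_0 [simp]: "avoid n d 0 = 0" by (cases d) auto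

text \<open>For \<open>j < n\<close> the increment of \<open>avoid n d\<close> at \<open>j\<close>
  is the probability of avoidance jointly with a longest run of length exactly \<open>j\<close> at
  the node. It is at most the marginal \<open>\<delta> j\<close>, and the last conjunct is the
  correlation inequality with the product of the marginals. The bounds are proved together because
  the inductive step for one uses others.\<close>

lemma avoid_increments:
  "0 \<le> avoid n d j \<and> avoid n d j \<le> short j \<and> avoid n d (Suc j) - avoid n d j \<le> \<delta> j \<and>
    u n d * \<delta> j \<le> avoid n d (Suc j) - avoid n d j"
proof (induction d arbitrary: j)
  case 0
  have "short n * \<delta> j \<le> 1 * \<delta> j"
    using short_le_1 \<delta>_nonneg by (intro mult_right_mono) auto
  then show ?case using short_nonneg by (simp add: \<delta>_def)
next
  case (Suc d)
  have nn: "0 \<le> avoid n d k" and le: "avoid n d k \<le> short k" 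
    and inc: "avoid n d (Suc k) - avoid n d k \<le> \<delta> k"
    and dec: "u n d * \<delta> k \<le> avoid n d (Suc k) - avoid n d k" for k
    using Suc by auto
  have dec': "u n d * short (Suc k) - u n d * short k \<le> avoid n d (Suc k) - avoid n d k" for k
    using dec[of k] by (simp add: \<delta>_def algebra_simps)
  have mono: "avoid n d k \<le> avoid n d (Suc k)" for k
    using dec[of k] nn[of n] \<delta>_nonneg[of k] mult_nonneg_nonneg[of "u n d" "\<delta> k"] by linarith
  \<comment> \<open>Summing \<open>dec'\<close> from 0, where both sides vanish, orders the base
    points as \<open>power_diff_mono_increments\<close> requires.\<close>
  have ge: "u n d * short k \<le> avoid n d k" for k
  proof (induction k)
    case (Suc k)
    then show ?case using dec'[of k] by linarith
  qed simp
  have u1: "u n d \<le> 1" using le[of n] short_le_1[of n] by linarith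
  then have ur1: "u n d ^ r \<le> 1" using nn by (intro power_le_one) auto
  have ule: "u n (Suc d) \<le> u n d ^ r"
  proof (cases n)
    case 0
    then show ?thesis by simp
  next
    case (Suc k)
    have "p * avoid n d k ^ r \<le> p * u n d ^ r"
      using mono[of k] nn[of k] p_pos Suc by (intro mult_left_mono power_mono) auto
    then show ?thesis using Suc by (simp add: algebra_simps)
  qed
  have "0 \<le> u n d ^ r" using nn by simp
  have sle: "(1 - p) * u n d ^ r \<le> 1 - p"
    using ur1 p_less_1 mult_left_mono[of "u n d ^ r" 1 "1 - p"] by simp
  have 1: "0 \<le> avoid n (Suc d) j"
    using nn p_pos p_less_1 by (cases j) auto
  have 2: "avoid n (Suc d) j \<le> short j"
  proof (cases j)
    case (Suc k)
    have "p * avoid n d k ^ r \<le> p * short k ^ r"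
      using nn le p_pos by (intro mult_left_mono power_mono) auto
    then show ?thesis using sle Suc by simp
  qed simp
  have 3: "avoid n (Suc d) (Suc j) - avoid n (Suc d) j \<le> \<delta> j"
  proof (cases j)
    case 0
    then show ?thesis using sle r_ge_2 by (simp add: \<delta>_def)
  next
    case (Suc k)
    have "avoid n d (Suc k) ^ r - avoid n d k ^ r \<le> short (Suc k) ^ r - short k ^ r"
      using nn le inc mono by (intro power_diff_mono_increments) (auto simp: \<delta>_def)
    then have "p * (avoid n d (Suc k) ^ r - avoid n d k ^ r) \<le> p * (short (Suc k) ^ r - short k ^ r)"
      using p_pos by (intro mult_left_mono) auto
    then show ?thesis using Suc by (simp add: \<delta>_def algebra_simps)
  qed
  \<comment> \<open>There is equality for \<open>j = 0\<close>. Otherwise the increments of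
    \<open>u n d * short k\<close> are compared with those of \<open>avoid n d k\<close>, and the
    \<open>r\<close>-th power brings out the factor \<open>u n d ^ r\<close>, which
    \<open>ule\<close> then lowers to \<open>u n (Suc d)\<close>.\<close>
  have "u n d ^ r * \<delta> j \<le> avoid n (Suc d) (Suc j) - avoid n (Suc d) j"
  proof (cases j)
    case 0
    then show ?thesis using r_ge_2 by (simp add: \<delta>_def power_0_left mult.commute)
  next
    case (Suc k)
    have m: "u n d * short k \<le> u n d * short (Suc k)"
      using nn short_mono_Suc by (intro mult_left_mono) auto
    have "(u n d * short (Suc k)) ^ r - (u n d * short k) ^ r \<le> avoid n d (Suc k) ^ r - avoid n d k ^ r"
      using nn ge dec' m short_nonneg by (intro power_diff_mono_increments) auto
    then have "p * ((u n d * short (Suc k)) ^ r - (u n d * short k) ^ r)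
        \<le> p * (avoid n d (Suc k) ^ r - avoid n d k ^ r)"
      using p_pos by (intro mult_left_mono) auto
    then show ?thesis
      unfolding Suc \<delta>_Suc power_mult_distrib by (simp add: algebra_simps del: short.simps)
  qed
  moreover have "u n (Suc d) * \<delta> j \<le> u n d ^ r * \<delta> j"
    using ule \<delta>_nonneg by (intro mult_right_mono) auto
  ultimately show ?case using 1 2 3 by linarith
qed

lemma u_nonneg: "0 \<le> u n d" and u_le_1: "u n d \<le> 1"
  using avoid_increments[of n d n] short_le_1[of n] by auto

lemma avoid_mono_Suc: "avoid n d j \<le> avoid n d (Suc j)"
  using avoid_increments[of n d j] mult_nonneg_nonneg[OF u_nonneg[of n d] \<delta>_nonneg[of j]]
  by linarith

lemma avoid_ge: "u n d * short j \<le> avoid n d j"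
proof (induction j)
  case (Suc j)
  then show ?case using avoid_increments[of n d j] by (simp add: \<delta>_def algebra_simps)
qed simp

text \<open>The loss \<open>u n d ^ r - u n (Suc d)\<close> is the probability that the root is
  open, every child avoids length \<open>n\<close>, and some child starts a run of length
  \<open>n - 1\<close>. The increment bounds at \<open>k = n - 1\<close>, raised to the
  \<open>r\<close>-th power, place it between \<open>u n d ^ r * \<delta> n\<close> and
  \<open>\<delta> n\<close>.\<close>

lemma u_Suc_bounds:
  assumes "0 < n"
  shows "u n d ^ r - \<delta> n \<le> u n (Suc d)" "u n (Suc d) \<le> u n d ^ r * (1 - \<delta> n)"
proof -
  obtain k where n: "n = Suc k" using assms gr0_implies_Suc by blast
  have \<delta>: "\<delta> n = p * (short n ^ r - short k ^ r)" by (simp add: n \<delta>_def algebra_simps)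
  have eq: "u n d ^ r - u n (Suc d) = p * (u n d ^ r - avoid n d k ^ r)"
    by (simp add: n algebra_simps)
  have "u n d ^ r - avoid n d k ^ r \<le> short n ^ r - short k ^ r"
    using avoid_increments[of n d k] avoid_mono_Suc[of n d k]
    by (intro power_diff_mono_increments) (auto simp: n \<delta>_def)
  then show "u n d ^ r - \<delta> n \<le> u n (Suc d)"
    using eq \<delta> p_pos mult_left_mono[of _ _ p] by (smt (verit))
  have m: "u n d * short k \<le> u n d * short n"
    using u_nonneg short_mono_Suc[of k] unfolding n by (intro mult_left_mono) auto
  have "(u n d * short n) ^ r - (u n d * short k) ^ r \<le> u n d ^ r - avoid n d k ^ r"
    using avoid_increments[of n d k] m avoid_ge[of n d k] short_nonneg u_nonneg
    by (intro power_diff_mono_increments) (auto simp: n \<delta>_def algebra_simps)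
  then have "p * ((u n d * short n) ^ r - (u n d * short k) ^ r) \<le> u n d ^ r - u n (Suc d)"
    unfolding eq using p_pos by (intro mult_left_mono) auto
  then show "u n (Suc d) \<le> u n d ^ r * (1 - \<delta> n)"
    unfolding \<delta> by (simp add: algebra_simps power_mult_distrib)
qed

section \<open>Iteration of the two-sided recursion\<close>

definition S :: "nat \<Rightarrow> real" where "S m = (\<Sum>i<m. real r ^ i)"

lemma S_0 [simp]: "S 0 = 0" by (simp add: S_def)

text \<open>\<open>S m\<close> counts the nodes of generation below \<open>m\<close>. Splitting off
  the root shows how losses accumulate: an \<open>r\<close>-th power multiplies the old ones by
  \<open>r\<close>, and each step adds one \<open>\<delta> n\<close>.\<close>

lemma S_Suc: "S (Suc m) = real r * S m + 1"
  unfolding S_def by (subst sum.lessThan_Suc_shift) (simp add: sum_distrib_left)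

lemma S_eq: "S m = (real r ^ m - 1) / (real r - 1)"
  using r_ge_2 by (simp add: S_def geometric_sum)

lemma S_nonneg: "0 \<le> S m" by (simp add: S_def sum_nonneg)

lemma S_le: "S m \<le> real r ^ m"
proof (induction m)
  case (Suc m)
  have "real r ^ m * 1 \<le> real r ^ m * (real r - 1)"
    using r_ge_2 by (intro mult_left_mono) auto
  then show ?case using Suc by (simp add: S_def algebra_simps)
qed simp

lemma u_le_exp:
  assumes "0 < n"
  shows "u n d \<le> exp (- (real r ^ d * long n + S d * \<delta> n))"
proof (induction d)
  case 0
  then show ?case using exp_ge_add_one_self[of "- long n"] by (simp add: long_def)
next
  case (Suc d)
  have "u n (Suc d) \<le> u n d ^ r * (1 - \<delta> n)" using u_Suc_bounds(2)[OF assms] .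
  also have "\<dots> \<le> exp (- (real r ^ d * long n + S d * \<delta> n)) ^ r * exp (- \<delta> n)"
    using Suc u_nonneg exp_ge_add_one_self[of "- \<delta> n"] \<delta>_le_long[of n] long_le_1[of n]
    by (intro mult_mono power_mono) auto
  also have "\<dots> = exp (- (real r ^ Suc d * long n + S (Suc d) * \<delta> n))"
    by (simp add: S_Suc algebra_simps flip: exp_of_nat_mult exp_add)
  finally show ?case .
qed

text \<open>Each step loses \<open>\<delta> n\<close>, and earlier losses grow at most by the
  Lipschitz constant \<open>r\<close>. The free starting generation \<open>k\<close> later allows a
  start where \<open>u n k\<close> is still close to 1.\<close>

lemma u_add_ge:
  assumes "0 < n"
  shows "u n k ^ (r ^ m) - S m * \<delta> n \<le> u n (k + m)"
proof (induction m)
  case (Suc m)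
  have "(u n k ^ (r ^ m)) ^ r - real r * (S m * \<delta> n) \<le> u n (k + m) ^ r"
    using Suc u_nonneg u_le_1 S_nonneg \<delta>_nonneg
    by (intro power_ge_power_minus) (auto simp: power_le_one)
  then show ?case
    using u_Suc_bounds(1)[OF assms, of "k + m"] by (simp add: S_Suc algebra_simps flip: power_mult)
qed simp

lemma u_ge_linear:
  assumes "0 < n"
  shows "1 - (real r ^ d * long n + S d * \<delta> n) \<le> u n d"
proof -
  have "1 + real (r ^ d) * (- long n) \<le> (1 + - long n) ^ (r ^ d)"
    using long_le_1[of n] by (intro Bernoulli_inequality) auto
  then show ?thesis
    using u_add_ge[OF assms, of 0 d] by (simp add: long_def algebra_simps)
qed

text \<open>Crude form for the tail bounds: \<open>S d * \<delta> n\<close> is at most the main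
  term, hence the factor 2.\<close>

lemma u_ge:
  assumes "0 < n"
  shows "1 - 2 * real r ^ d * long n \<le> u n d"
proof -
  have "S d * \<delta> n \<le> real r ^ d * long n"
    using S_le \<delta>_le_long \<delta>_nonneg by (intro mult_mono) auto
  then show ?thesis using u_ge_linear[OF assms, of d] by linarith
qed

end

section \<open>Open runs as local events\<close>

text \<open>The empty run makes length 0 unavoidable, hence \<open>False\<close>. The conditional
  stands under the quantifier over children so that this recursion and the next have the shape of
  \<open>local_event_branch\<close> and \<open>prob_branch\<close>.\<close>

primrec no_run :: "nat \<Rightarrow> nat \<Rightarrow> (nat list \<Rightarrow> bool) \<Rightarrow> nat list \<Rightarrow> bool" where
  "no_run r 0 x v \<longleftrightarrow> False"
| "no_run r (Suc j) x v \<longleftrightarrow> (\<forall>i<r. if x v then no_run r j x (v @ [i]) else True)"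

fun avoids :: "nat \<Rightarrow> nat \<Rightarrow> nat \<Rightarrow> nat \<Rightarrow> (nat list \<Rightarrow> bool) \<Rightarrow> nat list \<Rightarrow> bool" where
  "avoids r n 0 j x v \<longleftrightarrow> no_run r j x v"
| "avoids r n (Suc d) 0 x v \<longleftrightarrow> False"
| "avoids r n (Suc d) (Suc j) x v \<longleftrightarrow>
     (\<forall>i<r. if x v then avoids r n d j x (v @ [i]) else avoids r n d n x (v @ [i]))"

lemma no_run_mono: "no_run r j x v \<Longrightarrow> j \<le> k \<Longrightarrow> no_run r k x v"
proof (induction j arbitrary: k v)
  case (Suc j)
  then obtain l where "k = Suc l" "j \<le> l" by (cases k) auto
  then show ?case using Suc by auto
qed simp

definition open_run_at :: "nat \<Rightarrow> (nat list \<Rightarrow> bool) \<Rightarrow> nat list \<Rightarrow> nat list list \<Rightarrow> bool" where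
  "open_run_at r x v A \<longleftrightarrow> A = [] \<or> is_run r A \<and> (\<forall>w\<in>set A. x w) \<and> hd A = v"

lemma open_run_at_Cons:
  assumes "v \<in> tree_nodes r"
  shows "open_run_at r x v (w # A) \<longleftrightarrow> w = v \<and> x v \<and> (A = [] \<or> (\<exists>i<r. open_run_at r x (v @ [i]) A))"
  using assms by (cases A) (auto simp: open_run_at_def is_run_def is_child_def)

lemma all_list_iff: "(\<forall>A. P A) \<longleftrightarrow> P [] \<and> (\<forall>w A. P (w # A))"
  by (metis list.exhaust)

lemma tree_nodes_child: "v \<in> tree_nodes r \<Longrightarrow> i < r \<Longrightarrow> v @ [i] \<in> tree_nodes r"
  by (simp add: tree_nodes_def)

lemma no_run_iff:
  assumes "0 < r" "v \<in> tree_nodes r"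
  shows "no_run r j x v \<longleftrightarrow> (\<forall>A. open_run_at r x v A \<longrightarrow> length A < j)"
  using assms(2)
proof (induction j arbitrary: v)
  case 0
  have "open_run_at r x v []" by (simp add: open_run_at_def)
  then show ?case by auto
next
  case (Suc j)
  have "(\<forall>A. open_run_at r x v A \<longrightarrow> length A < Suc j) \<longleftrightarrow>
      (\<forall>w A. open_run_at r x v (w # A) \<longrightarrow> length A < j)"
    by (subst all_list_iff) auto
  also have "\<dots> \<longleftrightarrow> (x v \<longrightarrow> (\<forall>i<r. \<forall>A. open_run_at r x (v @ [i]) A \<longrightarrow> length A < j))"
  proof -
    \<comment> \<open>The empty list is a run at every child, and \<open>0 < r\<close> provides a
      child, so the first disjunct is absorbed.\<close>
    have "A = [] \<or> (\<exists>i<r. open_run_at r x (v @ [i]) A) \<longleftrightarrow> (\<exists>i<r. open_run_at r x (v @ [i]) A)" for A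
      using assms(1) by (auto simp: open_run_at_def)
    then show ?thesis unfolding open_run_at_Cons[OF Suc.prems] by blast
  qed
  also have "\<dots> \<longleftrightarrow> no_run r (Suc j) x v"
    using Suc by (auto simp: tree_nodes_child)
  finally show ?case by simp
qed

text \<open>Proper descendants of \<open>v\<close> are sorted by the child they lie below. By
  \<open>j \<le> n\<close>, the condition at \<open>v\<close> itself, the case
  \<open>w = []\<close>, follows from \<open>no_run r j x v\<close>.\<close>

lemma avoids_iff:
  assumes "j \<le> n"
  shows "avoids r n d j x v \<longleftrightarrow>
    no_run r j x v \<and> (\<forall>w\<in>tree_nodes r. length w \<le> d \<longrightarrow> no_run r n x (v @ w))"
  using assms
proof (induction d arbitrary: j v)
  case 0
  then show ?case using no_run_mono by (auto simp: tree_nodes_def)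
next
  case (Suc d)
  show ?case
  proof (cases j)
    case 0
    then show ?thesis by simp
  next
    case (Suc k)
    have k: "k \<le> n" "k < n" using Suc \<open>j \<le> n\<close> by auto
    have split: "(\<forall>w\<in>tree_nodes r. length w \<le> Suc d \<longrightarrow> no_run r n x (v @ w)) \<longleftrightarrow>
      no_run r n x v \<and> (\<forall>i<r. \<forall>w\<in>tree_nodes r. length w \<le> d \<longrightarrow> no_run r n x ((v @ [i]) @ w))"
      (is "?L \<longleftrightarrow> ?R")
    proof
      assume L: ?L
      have "no_run r n x ((v @ [i]) @ w)" if "i < r" "w \<in> tree_nodes r" "length w \<le> d" for i w
        using L[rule_format, of "i # w"] that by (auto simp: tree_nodes_def)
      moreover have "no_run r n x v" using L[rule_format, of "[]"] by (auto simp: tree_nodes_def)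
      ultimately show ?R by blast
    next
      assume R: ?R
      show ?L
      proof (intro ballI impI)
        fix w assume w: "w \<in> tree_nodes r" "length w \<le> Suc d"
        show "no_run r n x (v @ w)"
        proof (cases w)
          case Nil
          then show ?thesis using R by simp
        next
          case (Cons i w')
          then show ?thesis using R w by (auto simp: tree_nodes_def)
        qed
      qed
    qed
    have root: "no_run r n x w" if "w = v @ [i]" "i < r"
      "\<forall>w'\<in>tree_nodes r. length w' \<le> d \<longrightarrow> no_run r n x (w @ w')" for i w
      using that(3)[rule_format, of "[]"] by (simp add: tree_nodes_def)
    have top: "no_run r n x v" if "no_run r (Suc k) x v"
      using no_run_mono[OF that] \<open>j \<le> n\<close> Suc by simp
    show ?thesis
      unfolding split Suc avoids.simps Suc.IH[OF k(1)] Suc.IH[OF order.refl]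
      using top root by auto
  qed
qed

lemma avoids_root_iff:
  assumes "0 < r" "0 < n"
  shows "avoids r n d n x [] \<longleftrightarrow> (\<forall>l\<in>open_run_lengths r x d. l < n)"
proof -
  have "avoids r n d n x [] \<longleftrightarrow> (\<forall>w\<in>tree_nodes r. length w \<le> d \<longrightarrow> no_run r n x w)"
    by (subst avoids_iff) (auto simp: tree_nodes_def)
  also have "\<dots> \<longleftrightarrow> (\<forall>w\<in>tree_nodes r. \<forall>A. length w \<le> d \<longrightarrow> open_run_at r x w A \<longrightarrow> length A < n)"
    using assms by (auto simp: no_run_iff)
  also have "\<dots> \<longleftrightarrow> (\<forall>l\<in>open_run_lengths r x d. l < n)"
  proof (intro iffI ballI allI impI)
    fix l assume H: "\<forall>w\<in>tree_nodes r. \<forall>A. length w \<le> d \<longrightarrow> open_run_at r x w A \<longrightarrow> length A < n"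
      and "l \<in> open_run_lengths r x d"
    then obtain A where A: "l = length A" "is_run r A" "\<forall>v\<in>set A. x v" "length (hd A) \<le> d"
      by (auto simp: open_run_lengths_def gen_def)
    then have "hd A \<in> tree_nodes r" using hd_in_set[of A] unfolding is_run_def by blast
    then show "l < n" using H A by (auto simp: open_run_at_def)
  next
    fix w A assume H: "\<forall>l\<in>open_run_lengths r x d. l < n"
      and w: "length w \<le> d" "open_run_at r x w A"
    show "length A < n"
    proof (cases "A = []")
      case False
      then have "length A \<in> open_run_lengths r x d"
        using w unfolding open_run_at_def open_run_lengths_def gen_def by blast
      then show ?thesis using H by blast
    qed (simp add: assms)
  qed
  finally show ?thesis .
qed

text \<open>The second disjunct stems from the default value 0 of \<open>longest_open_run\<close>,
  which is below \<open>n\<close>; \<open>infinite_lengths_null\<close> disposes of it.\<close>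

lemma longest_open_run_less_iff:
  assumes "0 < r" "0 < n"
  shows "longest_open_run r x d < n \<longleftrightarrow>
    avoids r n d n x [] \<or> infinite (open_run_lengths r x d)"
  using assms by (auto simp: longest_open_run_def avoids_root_iff[OF assms])

text \<open>Infinite means unbounded for sets of naturals; this expresses the event as a countable
  intersection, which gives its measurability.\<close>

lemma infinite_open_run_lengths_iff:
  assumes "0 < r"
  shows "infinite (open_run_lengths r x d) \<longleftrightarrow> (\<forall>n. \<not> avoids r (Suc n) d (Suc n) x [])"
  unfolding avoids_root_iff[OF assms zero_less_Suc] infinite_nat_iff_unbounded_le
  by (metis Suc_leD not_less)

section \<open>Events determined by a subtree\<close>

definition subtree :: "nat \<Rightarrow> nat list \<Rightarrow> nat list set" where
  "subtree r v = (@) v ` tree_nodes r"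

lemma subtree_refl [simp]: "v \<in> subtree r v"
  by (force simp: subtree_def tree_nodes_def)

lemma subtree_child: "i < r \<Longrightarrow> subtree r (v @ [i]) \<subseteq> subtree r v"
  by (force simp: subtree_def tree_nodes_def)

lemma subtree_subset: "v \<in> tree_nodes r \<Longrightarrow> subtree r v \<subseteq> tree_nodes r"
  by (auto simp: subtree_def tree_nodes_def)

abbreviation coin :: "nat list \<Rightarrow> bool measure" where "coin \<equiv> \<lambda>_. count_space UNIV"

text \<open>The restriction in the second clause states that \<open>A v\<close> depends on the subtree of \<open>v\<close> only, so that
  the events attached to distinct children are independent.\<close>

definition local_event :: "nat \<Rightarrow> (nat list \<Rightarrow> (nat list \<Rightarrow> bool) \<Rightarrow> bool) \<Rightarrow> bool" where
  "local_event r A \<longleftrightarrow> (\<forall>v. A v \<in> Pi\<^sub>M (subtree r v) coin \<rightarrow>\<^sub>M count_space UNIV \<and>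
     (\<forall>x. A v (restrict x (subtree r v)) = A v x))"

lemma local_event_const: "local_event r (\<lambda>_ _. b)"
  by (simp add: local_event_def)

text \<open>Closure under one recursion step: the coordinate \<open>v\<close> and the subtrees of
  its children lie in \<open>subtree r v\<close>.\<close>

lemma local_event_branch:
  assumes A: "local_event r A" and B: "local_event r B"
  shows "local_event r (\<lambda>v x. \<forall>i<r. if x v then A (v @ [i]) x else B (v @ [i]) x)"
proof -
  have res: "E (v @ [i]) (restrict x (subtree r v)) = E (v @ [i]) x"
    if E: "local_event r E" and "i < r" for E v i x
  proof -
    have "subtree r v \<inter> subtree r (v @ [i]) = subtree r (v @ [i])"
      using subtree_child[OF \<open>i < r\<close>] by auto
    then show ?thesis
      using E restrict_restrict[of x "subtree r v" "subtree r (v @ [i])"]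
      unfolding local_event_def by metis
  qed
  have meas: "E (v @ [i]) \<in> Pi\<^sub>M (subtree r v) coin \<rightarrow>\<^sub>M count_space UNIV"
    if E: "local_event r E" and "i < r" for E v i
  proof -
    have "(\<lambda>x. E (v @ [i]) (restrict x (subtree r (v @ [i])))) \<in>
        Pi\<^sub>M (subtree r v) coin \<rightarrow>\<^sub>M count_space UNIV"
      using E subtree_child[OF \<open>i < r\<close>] unfolding local_event_def
      by (intro measurable_compose[OF measurable_restrict_subset]) auto
    then show ?thesis using E by (simp add: local_event_def)
  qed
  have [measurable]: "Measurable.pred (Pi\<^sub>M (subtree r v) coin) (\<lambda>x. x v)" for v
    by (rule measurable_component_singleton) simp
  show ?thesis
    unfolding local_event_def
  proof (intro allI conjI)
    fix v
    have "Measurable.pred (Pi\<^sub>M (subtree r v) coin)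
        (\<lambda>x. \<forall>i\<in>{..<r}. (x v \<and> A (v @ [i]) x) \<or> (\<not> x v \<and> B (v @ [i]) x))"
      using meas[OF A] meas[OF B] by (intro pred_intros_finite) (auto intro!: pred_intros_logic)
    moreover have "(\<lambda>x. \<forall>i\<in>{..<r}. (x v \<and> A (v @ [i]) x) \<or> (\<not> x v \<and> B (v @ [i]) x)) =
        (\<lambda>x. \<forall>i<r. if x v then A (v @ [i]) x else B (v @ [i]) x)"
      by (rule ext) auto
    ultimately show "Measurable.pred (Pi\<^sub>M (subtree r v) coin)
        (\<lambda>x. \<forall>i<r. if x v then A (v @ [i]) x else B (v @ [i]) x)"
      by (rule subst[rotated])
    fix x :: "nat list \<Rightarrow> bool"
    have "restrict x (subtree r v) v = x v" by simp
    then show "(\<forall>i<r. if restrict x (subtree r v) v then A (v @ [i]) (restrict x (subtree r v))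
        else B (v @ [i]) (restrict x (subtree r v))) =
      (\<forall>i<r. if x v then A (v @ [i]) x else B (v @ [i]) x)"
      by (simp only: res[OF A] res[OF B] cong: imp_cong)
  qed
qed

lemma local_event_no_run: "local_event r (\<lambda>v x. no_run r j x v)"
proof (induction j)
  case 0
  then show ?case by (simp add: local_event_const)
next
  case (Suc j)
  then show ?case
    unfolding no_run.simps using local_event_const[of r True] by (intro local_event_branch)
qed

lemma local_event_avoids: "local_event r (\<lambda>v x. avoids r n d j x v)"
proof (induction d arbitrary: j)
  case 0
  then show ?case by (simp add: local_event_no_run)
next
  case (Suc d)
  show ?case
  proof (cases j)
    case 0
    then show ?thesis by (simp add: local_event_const)
  next
    case (Suc k)
    then show ?thesis unfolding Suc avoids.simps using Suc.IH by (intro local_event_branch)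
  qed
qed

section \<open>The distribution of the longest open run\<close>

locale bernoulli_tree = subcritical r p + prob_space M
  for r p and M :: "'a measure" +
  fixes X :: "nat list \<Rightarrow> 'a \<Rightarrow> bool"
  assumes indep: "indep_vars coin X (tree_nodes r)"
    and law: "v \<in> tree_nodes r \<Longrightarrow> distr M (count_space UNIV) (X v) = measure_pmf (bernoulli_pmf p)"
begin

lemma measurable_X: "v \<in> tree_nodes r \<Longrightarrow> X v \<in> M \<rightarrow>\<^sub>M count_space UNIV"
  using indep by (simp add: indep_vars_def2)

lemma prob_X:
  assumes "v \<in> tree_nodes r"
  shows "prob {\<omega>\<in>space M. X v \<omega> = q} = (if q then p else 1 - p)"
proof -
  have "prob {\<omega>\<in>space M. X v \<omega> = q} = prob (X v -` {q} \<inter> space M)"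
    by (intro arg_cong[of _ _ prob]) auto
  also have "\<dots> = measure (distr M (count_space UNIV) (X v)) {q}"
    using measurable_X[OF assms] by (subst measure_distr) auto
  also have "\<dots> = pmf (bernoulli_pmf p) q" by (simp add: law[OF assms] measure_pmf_single)
  finally show ?thesis using p_pos p_less_1 by (cases q) auto
qed

text \<open>\<open>X w\<close> is measurable for tree nodes \<open>w\<close>, so the event is read
  off the restriction to \<open>subtree r v\<close>.\<close>

lemma local_event_measurable:
  assumes "local_event r A" "v \<in> tree_nodes r"
  shows "(\<lambda>\<omega>. A v (\<lambda>w. X w \<omega>)) \<in> M \<rightarrow>\<^sub>M count_space UNIV"
proof -
  have "(\<lambda>\<omega>. A v (\<lambda>w\<in>subtree r v. X w \<omega>)) \<in> M \<rightarrow>\<^sub>M count_space UNIV"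
    using assms subtree_subset[OF assms(2)] measurable_X unfolding local_event_def
    by (intro measurable_compose[OF measurable_restrict]) auto
  then show ?thesis using assms(1) by (simp add: local_event_def)
qed

text \<open>The node and the subtrees of its \<open>r\<close> children are disjoint blocks of
  coordinates, so the events they carry are independent.\<close>

lemma prob_children:
  assumes A: "local_event r A" and v: "v \<in> tree_nodes r"
    and a: "\<And>i. i < r \<Longrightarrow> prob {\<omega>\<in>space M. A (v @ [i]) (\<lambda>w. X w \<omega>)} = a"
  shows "prob {\<omega>\<in>space M. X v \<omega> = q \<and> (\<forall>i<r. A (v @ [i]) (\<lambda>w. X w \<omega>))} =
    (if q then p else 1 - p) * a ^ r"
proof -
  \<comment> \<open>Index \<open>r\<close> stands for the node itself, index \<open>j < r\<close>
    for the subtree of the child \<open>v @ [j]\<close>.\<close>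
  define K where "K j = (if j = r then {v} else subtree r (v @ [j]))" for j
  define Y where "Y j x = (if j = r then x v = q else A (v @ [j]) x)" for j and x :: "nat list \<Rightarrow> bool"
  have K: "K j \<subseteq> tree_nodes r" if "j \<in> {..r}" for j
    using that v subtree_subset[OF tree_nodes_child[OF v]] by (auto simp: K_def)
  have disj: "disjoint_family_on K {..r}"
    by (auto simp: disjoint_family_on_def K_def subtree_def)
  have "Y j \<in> Pi\<^sub>M (K j) coin \<rightarrow>\<^sub>M count_space UNIV" if "j \<in> {..r}" for j
  proof (cases "j = r")
    case True
    have [measurable]: "Measurable.pred (Pi\<^sub>M {v} coin) (\<lambda>x. x v)"
      by (rule measurable_component_singleton) simp
    have "Measurable.pred (Pi\<^sub>M {v} coin) (\<lambda>x. x v = q)" by (cases q) simp_all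
    moreover have "Y j = (\<lambda>x. x v = q)" using True by (simp add: Y_def fun_eq_iff)
    ultimately show ?thesis using True by (simp add: K_def)
  next
    case False
    moreover from False have "Y j = A (v @ [j])" by (simp add: Y_def fun_eq_iff)
    ultimately show ?thesis using A by (simp add: K_def local_event_def)
  qed
  then have iv: "indep_vars (\<lambda>_. count_space UNIV) (\<lambda>j \<omega>. Y j (\<lambda>w\<in>K j. X w \<omega>)) {..r}"
    by (intro indep_vars_compose2[OF indep_vars_restrict[OF indep K disj]])
  have Y: "Y j (\<lambda>w\<in>K j. X w \<omega>) = Y j (\<lambda>w. X w \<omega>)" for j \<omega>
    using A by (auto simp: Y_def K_def local_event_def)
  have atMost: "{..r} = insert r {..<r}" by auto
  have "{\<omega>\<in>space M. X v \<omega> = q \<and> (\<forall>i<r. A (v @ [i]) (\<lambda>w. X w \<omega>))} =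
      (\<Inter>j\<in>{..r}. (\<lambda>\<omega>. Y j (\<lambda>w. X w \<omega>)) -` {True} \<inter> space M)"
    unfolding atMost by (auto simp: Y_def)
  also have "prob \<dots> = (\<Prod>j\<in>{..r}. prob ((\<lambda>\<omega>. Y j (\<lambda>w. X w \<omega>)) -` {True} \<inter> space M))"
    using iv unfolding Y by (intro indep_varsD_finite) auto
  also note atMost
  also have "(\<Prod>j\<in>insert r {..<r}. prob ((\<lambda>\<omega>. Y j (\<lambda>w. X w \<omega>)) -` {True} \<inter> space M)) =
      prob {\<omega>\<in>space M. X v \<omega> = q} * (\<Prod>i<r. prob {\<omega>\<in>space M. A (v @ [i]) (\<lambda>w. X w \<omega>)})"
  proof -
    have "(\<lambda>\<omega>. Y r (\<lambda>w. X w \<omega>)) -` {True} \<inter> space M = {\<omega>\<in>space M. X v \<omega> = q}"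
      by (auto simp: Y_def)
    moreover have "(\<lambda>\<omega>. Y i (\<lambda>w. X w \<omega>)) -` {True} \<inter> space M =
        {\<omega>\<in>space M. A (v @ [i]) (\<lambda>w. X w \<omega>)}" if "i < r" for i
      using that by (auto simp: Y_def)
    ultimately show ?thesis by simp
  qed
  also have "\<dots> = (if q then p else 1 - p) * a ^ r" using prob_X[OF v] a by simp
  finally show ?thesis .
qed

lemma prob_branch:
  assumes A: "local_event r A" and B: "local_event r B" and v: "v \<in> tree_nodes r"
    and a: "\<And>w. w \<in> tree_nodes r \<Longrightarrow> prob {\<omega>\<in>space M. A w (\<lambda>w. X w \<omega>)} = a"
    and b: "\<And>w. w \<in> tree_nodes r \<Longrightarrow> prob {\<omega>\<in>space M. B w (\<lambda>w. X w \<omega>)} = b"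
  shows "prob {\<omega>\<in>space M. \<forall>i<r. if X v \<omega> then A (v @ [i]) (\<lambda>w. X w \<omega>) else B (v @ [i]) (\<lambda>w. X w \<omega>)} =
    p * a ^ r + (1 - p) * b ^ r"
proof -
  define U where "U E q = {\<omega>\<in>space M. X v \<omega> = q \<and> (\<forall>i<r. E (v @ [i]) (\<lambda>w. X w \<omega>))}" for E q
  have meas: "U E q \<in> events" if "local_event r E" for E q
  proof -
    have [measurable]: "Measurable.pred M (X v)" by (rule measurable_X[OF v])
    have [measurable]: "Measurable.pred M (\<lambda>\<omega>. \<forall>i\<in>{..<r}. E (v @ [i]) (\<lambda>w. X w \<omega>))"
      using local_event_measurable[OF that] v by (intro pred_intros_finite) (auto simp: tree_nodes_child)
    have "{\<omega>\<in>space M. X v \<omega> = q \<and> (\<forall>i\<in>{..<r}. E (v @ [i]) (\<lambda>w. X w \<omega>))} \<in> events"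
      by (cases q) simp_all
    also have "{\<omega>\<in>space M. X v \<omega> = q \<and> (\<forall>i\<in>{..<r}. E (v @ [i]) (\<lambda>w. X w \<omega>))} = U E q"
      unfolding U_def by blast
    finally show ?thesis .
  qed
  have "{\<omega>\<in>space M. \<forall>i<r. if X v \<omega> then A (v @ [i]) (\<lambda>w. X w \<omega>) else B (v @ [i]) (\<lambda>w. X w \<omega>)} =
      U A True \<union> U B False"
    by (auto simp: U_def)
  also have "prob \<dots> = prob (U A True) + prob (U B False)"
    by (intro finite_measure_Union meas A B) (auto simp: U_def)
  also have "\<dots> = p * a ^ r + (1 - p) * b ^ r"
    using prob_children[OF A v, of a True] prob_children[OF B v, of b False] a b v
    by (simp add: U_def tree_nodes_child)
  finally show ?thesis .
qed

lemma prob_no_run: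
  "v \<in> tree_nodes r \<Longrightarrow> prob {\<omega>\<in>space M. no_run r j (\<lambda>w. X w \<omega>) v} = short j"
proof (induction j arbitrary: v)
  case (Suc j)
  \<comment> \<open>Below a closed node nothing is required: the sure event, of probability 1,
    yields the summand \<open>1 - p\<close>.\<close>
  show ?case
    using prob_branch[OF local_event_no_run local_event_const[of r True] Suc.prems Suc.IH, of 1]
    by (simp add: prob_space)
qed simp

lemma prob_avoids:
  "v \<in> tree_nodes r \<Longrightarrow> prob {\<omega>\<in>space M. avoids r n d j (\<lambda>w. X w \<omega>) v} = avoid n d j"
proof (induction d arbitrary: j v)
  case 0
  then show ?case by (simp add: prob_no_run)
next
  case (Suc d)
  show ?case
  proof (cases j)
    case (Suc k)
    then show ?thesis
      using prob_branch[OF local_event_avoids local_event_avoids Suc.prems Suc.IH Suc.IH]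
      by simp
  qed simp
qed

lemma root_node: "[] \<in> tree_nodes r" by (simp add: tree_nodes_def)

lemma sets_avoids: "{\<omega>\<in>space M. avoids r n d j (\<lambda>w. X w \<omega>) []} \<in> events"
  using local_event_measurable[OF local_event_avoids root_node] by simp

lemma r_pos: "0 < r" using r_ge_2 by simp

text \<open>The probability is at most \<open>1 - u (Suc n) d\<close> for every \<open>n\<close>,
  and this decays geometrically in \<open>n\<close> for fixed \<open>d\<close>.\<close>

lemma infinite_lengths_null:
  "{\<omega>\<in>space M. infinite (open_run_lengths r (\<lambda>w. X w \<omega>) d)} \<in> null_sets M"
proof -
  let ?I = "{\<omega>\<in>space M. infinite (open_run_lengths r (\<lambda>w. X w \<omega>) d)}"
  let ?E = "\<lambda>n. {\<omega>\<in>space M. avoids r (Suc n) d (Suc n) (\<lambda>w. X w \<omega>) []}"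
  have I: "?I = (\<Inter>n. space M - ?E n)"
    by (auto simp: infinite_open_run_lengths_iff[OF r_pos])
  then have meas: "?I \<in> events" using sets_avoids by auto
  have "prob ?I \<le> 2 * real r ^ d * \<beta> ^ Suc n" for n
  proof -
    have "prob ?I \<le> prob (space M - ?E n)" 
      using sets_avoids by (intro finite_measure_mono) (auto simp: I)
    also have "\<dots> = 1 - u (Suc n) d"
      using sets_avoids by (simp add: prob_compl prob_avoids[OF root_node])
    also have "\<dots> \<le> 2 * real r ^ d * long (Suc n)" using u_ge[of "Suc n" d] by simp
    also have "\<dots> \<le> 2 * real r ^ d * \<beta> ^ Suc n"
      by (intro mult_left_mono long_le_power) auto
    finally show ?thesis .
  qed
  moreover have "(\<lambda>n. 2 * real r ^ d * \<beta> ^ Suc n) \<longlonglongrightarrow> 2 * real r ^ d * 0"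
    using \<beta>_pos \<beta>_less_1 by (intro tendsto_intros LIMSEQ_Suc LIMSEQ_power_zero) auto
  ultimately have "prob ?I \<le> 0" by (intro LIMSEQ_le_const[of _ 0]) auto
  then have "prob ?I = 0" using measure_nonneg[of M ?I] by linarith
  then show ?thesis using meas by (simp add: null_sets_def emeasure_eq_measure)
qed

lemma
  assumes "0 < n"
  shows sets_R_less: "{\<omega>\<in>space M. R r X d \<omega> < n} \<in> events"
    and prob_R_less: "prob {\<omega>\<in>space M. R r X d \<omega> < n} = u n d"
proof -
  let ?I = "{\<omega>\<in>space M. infinite (open_run_lengths r (\<lambda>w. X w \<omega>) d)}"
  let ?E = "{\<omega>\<in>space M. avoids r n d n (\<lambda>w. X w \<omega>) []}"
  have eq: "{\<omega>\<in>space M. R r X d \<omega> < n} = ?E \<union> ?I"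
    by (auto simp: R_def longest_open_run_less_iff[OF r_pos assms])
  show "{\<omega>\<in>space M. R r X d \<omega> < n} \<in> events"
    unfolding eq using sets_avoids infinite_lengths_null by blast
  have "prob (?E \<union> ?I) = prob ?E"
    using infinite_lengths_null[of d] sets_avoids[of n d n] by (intro measure_Un_null_set) 
  then show "prob {\<omega>\<in>space M. R r X d \<omega> < n} = u n d"
    unfolding eq by (simp add: prob_avoids[OF root_node])
qed

lemma measurable_R: "R r X d \<in> M \<rightarrow>\<^sub>M count_space UNIV"
proof -
  have "R r X d -` {k} \<inter> space M \<in> events" for k
  proof -
    have 0: "{\<omega>\<in>space M. R r X d \<omega> < k} \<in> events" 
      using sets_R_less[of k d] by (cases "k = 0") auto
    have "R r X d -` {k} \<inter> space M =
        {\<omega>\<in>space M. R r X d \<omega> < Suc k} - {\<omega>\<in>space M. R r X d \<omega> < k}"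
      by auto
    then show ?thesis using 0 sets_R_less[of "Suc k" d] by auto
  qed
  then show ?thesis by (simp add: measurable_count_space_eq2_countable)
qed

end

lemma bernoulli_tree_iff:
  assumes "subcritical r p"
  shows "bernoulli_tree r p M X \<longleftrightarrow> iid_bernoulli M r p X"
  using assms by (auto simp: bernoulli_tree_def bernoulli_tree_axioms_def iid_bernoulli_def)

section \<open>The Gumbel limit\<close>

lemma powr_tendsto_0_at_top:
  fixes b :: real
  assumes "0 < b" "b < 1"
  shows "((\<lambda>z. b powr z) \<longlongrightarrow> 0) at_top"
proof -
  have "filterlim (\<lambda>z. ln b * z) at_bot at_top"
    using assms by (intro filterlim_tendsto_neg_mult_at_bot[OF tendsto_const]) (auto simp: filterlim_ident)
  then have "((\<lambda>z. exp (ln b * z)) \<longlongrightarrow> 0) at_top"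
    by (rule filterlim_compose[OF exp_at_bot])
  then show ?thesis using assms by (simp add: powr_def mult.commute)
qed

lemma powr_at_top_at_bot:
  fixes b :: real
  assumes "0 < b" "b < 1"
  shows "filterlim (\<lambda>z. b powr z) at_top at_bot"
proof -
  have "filterlim (\<lambda>z. ln b * z) at_top at_bot"
    using filterlim_tendsto_pos_mult_at_bot[OF tendsto_const[of "- ln b"] _ filterlim_ident] assms
    by (simp add: filterlim_uminus_at_top)
  then have "filterlim (\<lambda>z. exp (ln b * z)) at_top at_bot"
    by (rule filterlim_compose[OF exp_at_top])
  then show ?thesis using assms by (simp add: powr_def mult.commute)
qed

text \<open>Inverts \<open>1 + t \<le> exp t\<close> at \<open>t = e / (1 - e)\<close>. It turns a
  linear lower bound into an exponential one that can be raised to a large power.\<close>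

lemma exp_neg_ratio_le:
  fixes e :: real
  assumes "e < 1"
  shows "exp (- (e / (1 - e))) \<le> 1 - e"
proof -
  have "1 / (1 - e) = 1 + e / (1 - e)" using assms by (simp add: field_simps)
  also have "\<dots> \<le> exp (e / (1 - e))" by (rule exp_ge_add_one_self)
  finally show ?thesis using assms by (simp add: exp_minus field_simps)
qed

lemma real_le_iff_less_Suc_floor:
  assumes "0 \<le> t"
  shows "real k \<le> t \<longleftrightarrow> k < Suc (nat \<lfloor>t\<rfloor>)"
  using assms by (simp add: less_Suc_eq_le le_nat_iff le_floor_iff)

context subcritical
begin

section \<open>The length scale of the longest run and the exponent of the limit\<close>

definition \<kappa> :: real where "\<kappa> = 1 / (log (real r) (1 / p) - 1)"

lemma \<kappa>_eq: "\<kappa> = - ln (real r) / ln \<beta>" and \<kappa>_pos: "0 < \<kappa>"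
proof -
  have lnr: "0 < ln (real r)" using r_ge_2 by simp
  have ln\<beta>: "ln \<beta> = ln (real r) + ln p" using r_ge_2 p_pos by (simp add: \<beta>_def ln_mult)
  have neg: "ln \<beta> < 0" using \<beta>_pos \<beta>_less_1 by simp
  have "log (real r) (1 / p) - 1 = - ln \<beta> / ln (real r)"
    using lnr p_pos unfolding ln\<beta> log_def by (simp add: ln_div field_simps)
  then show "\<kappa> = - ln (real r) / ln \<beta>" using lnr neg by (simp add: \<kappa>_def)
  then show "0 < \<kappa>" using divide_pos_neg[OF lnr neg] by simp
qed

lemma \<nu>_eq: "\<nu> r p d = real d * \<kappa>" by (simp add: \<nu>_def \<kappa>_def)

lemma \<nu>_nonneg: "0 \<le> \<nu> r p d" using \<kappa>_pos by (simp add: \<nu>_eq)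

text \<open>The centring is the length at which the growth \<open>r ^ d\<close> of the tree balances
  the decay \<open>\<beta> ^ n\<close> of \<open>long n\<close>.\<close>

lemma power_r_eq: "real r ^ d = \<beta> powr (- \<nu> r p d)"
proof -
  have "ln \<beta> \<noteq> 0" using \<beta>_pos \<beta>_less_1 by simp
  then have "- \<nu> r p d * ln \<beta> = real d * ln (real r)" by (simp add: \<nu>_eq \<kappa>_eq)
  then show ?thesis using \<beta>_pos r_ge_2 by (simp add: powr_def exp_of_nat_mult)
qed

lemma power_r_power_\<beta>: "real r ^ d * \<beta> ^ n = \<beta> powr (real n - \<nu> r p d)"
  using \<beta>_pos by (simp add: power_r_eq powr_realpow[symmetric] powr_add[symmetric])

lemma \<nu>_at_top: "filterlim (\<nu> r p) at_top sequentially"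
  unfolding \<nu>_eq using \<kappa>_pos
  by (intro filterlim_at_top_mult_tendsto_pos[OF tendsto_const]) (auto simp: filterlim_real_sequentially)

text \<open>The exponent of \<open>u_le_exp\<close>, an expected number of nodes: those of
  generation \<open>d\<close> count if a run of length \<open>n\<close> starts there, earlier ones
  only if their longest run has length exactly \<open>n\<close>, so that a longer run does not count
  once for each of its suffixes.\<close>

definition clumps :: "nat \<Rightarrow> nat \<Rightarrow> real" where
  "clumps n d = real r ^ d * long n + S d * \<delta> n"

text \<open>The sum of \<open>c\<close> from generation \<open>d\<close> and
  \<open>c * (1 - \<beta>) / (r - 1)\<close> from the earlier generations.\<close>

definition C :: real where "C = c * (1 - p) * real r / (real r - 1)"

lemma C_pos: "0 < C" using c_pos p_less_1 r_ge_2 by (simp add: C_def)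

lemma power_r_le_1: "1 \<le> real r ^ m" using r_ge_2 by simp

lemma clumps_le:
  assumes "d = k + m"
  shows "clumps n k \<le> clumps n d / real r ^ m"
proof -
  have "real r ^ m * S k \<le> S d"
  proof -
    have "real r ^ m * (real r ^ k - 1) \<le> real r ^ d - 1"
      using power_r_le_1[of m] by (simp add: assms power_add algebra_simps)
    then have "real r ^ m * (real r ^ k - 1) / (real r - 1) \<le> (real r ^ d - 1) / (real r - 1)"
      using r_ge_2 by (intro divide_right_mono) auto
    then show ?thesis by (simp add: S_eq)
  qed
  then have "real r ^ m * S k * \<delta> n \<le> S d * \<delta> n" using \<delta>_nonneg by (intro mult_right_mono)
  then have "real r ^ m * clumps n k \<le> clumps n d"
    by (simp add: clumps_def assms power_add algebra_simps)
  moreover have "0 < real r ^ m" using r_ge_2 by simp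
  ultimately show ?thesis by (subst pos_le_divide_eq) (simp_all only: mult.commute)
qed

text \<open>At generation \<open>k\<close> the exponent is at most
  \<open>clumps n d / r ^ m\<close>, so the linear bound is nearly sharp when this is small. The
  power \<open>r ^ m\<close> restores the full exponent, and the losses of the last \<open>m\<close>
  steps form the subtracted term.\<close>

lemma u_ge_exp_clumps:
  assumes n: "0 < n" and d: "d = k + m" and e: "clumps n d / real r ^ m < 1"
  shows "exp (- (clumps n d / (1 - clumps n d / real r ^ m))) - real r ^ d * long n / real r ^ k \<le> u n d"
proof -
  define \<epsilon> where "\<epsilon> = clumps n d / real r ^ m"
  have "exp (- (\<epsilon> / (1 - \<epsilon>))) \<le> u n k"
    using exp_neg_ratio_le[of \<epsilon>] e clumps_le[OF d, of n] u_ge_linear[OF n, of k]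
    unfolding \<epsilon>_def clumps_def by linarith
  then have "exp (- (\<epsilon> / (1 - \<epsilon>))) ^ (r ^ m) \<le> u n k ^ (r ^ m)"
    by (intro power_mono) auto
  also have "exp (- (\<epsilon> / (1 - \<epsilon>))) ^ (r ^ m) = exp (- (clumps n d / (1 - \<epsilon>)))"
    using r_ge_2 by (simp add: \<epsilon>_def flip: exp_of_nat_mult)
  also have "u n k ^ (r ^ m) \<le> u n d + S m * \<delta> n"
    using u_add_ge[OF n, of k m] d by simp
  also have "S m * \<delta> n \<le> real r ^ m * long n"
    using S_le \<delta>_le_long \<delta>_nonneg by (intro mult_mono) auto
  also have "\<dots> = real r ^ d * long n / real r ^ k"
    using r_ge_2 by (simp add: d power_add)
  finally show ?thesis by (simp add: \<epsilon>_def)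
qed

text \<open>Here \<open>n k\<close> tends to infinity, so \<open>long\<close> and
  \<open>\<delta>\<close> behave like \<open>c * \<beta> ^ n\<close> and
  \<open>c * (1 - \<beta>) * \<beta> ^ n\<close>, and \<open>S d\<close> like
  \<open>r ^ d / (r - 1)\<close>.\<close>

lemma
  assumes D: "filterlim D at_top sequentially"
    and y: "(\<lambda>k. real (n k) - \<nu> r p (D k)) \<longlonglongrightarrow> y"
  shows long_tendsto: "(\<lambda>k. real r ^ D k * long (n k)) \<longlonglongrightarrow> c * \<beta> powr y"
    and clumps_tendsto: "(\<lambda>k. clumps (n k) (D k)) \<longlonglongrightarrow> C * \<beta> powr y"
proof -
  have "filterlim (\<lambda>k. (real (n k) - \<nu> r p (D k)) + \<nu> r p (D k)) at_top sequentially"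
    by (intro filterlim_tendsto_add_at_top[OF y] filterlim_compose[OF \<nu>_at_top D])
  then have "filterlim (\<lambda>k. real (n k)) at_top sequentially" by simp
  then have n: "filterlim n at_top sequentially"
    by (rule filterlim_sequentially_iff_filterlim_real[THEN iffD2])
  have "filterlim (\<lambda>k. Suc (n k)) at_top sequentially"
    by (rule filterlim_compose[OF filterlim_Suc n])
  then have r1: "(\<lambda>k. ratio (Suc (n k))) \<longlonglongrightarrow> c"
    by (rule filterlim_compose[OF ratio_tendsto])
  have r0: "(\<lambda>k. ratio (n k)) \<longlonglongrightarrow> c"
    by (rule filterlim_compose[OF ratio_tendsto n])
  have pw: "(\<lambda>k. \<beta> powr (real (n k) - \<nu> r p (D k))) \<longlonglongrightarrow> \<beta> powr y"
    using \<beta>_pos y by (intro tendsto_intros) auto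
  have long: "long k = ratio k * \<beta> ^ k" for k using \<beta>_pos by (simp add: ratio_def)
  have L: "real r ^ D k * long (n k) = ratio (n k) * \<beta> powr (real (n k) - \<nu> r p (D k))" for k
    by (simp add: long flip: power_r_power_\<beta>)
  show lim: "(\<lambda>k. real r ^ D k * long (n k)) \<longlonglongrightarrow> c * \<beta> powr y"
    unfolding L by (intro tendsto_intros r0 pw)
  have "filterlim (\<lambda>k. real r ^ D k) at_infinity sequentially"
    using r_ge_2 by (intro filterlim_compose[OF _ D] filterlim_realpow_sequentially_gt1) auto
  then have inv: "(\<lambda>k. inverse (real r ^ D k)) \<longlonglongrightarrow> 0"
    by (rule filterlim_compose[OF tendsto_inverse_0])
  have Sd: "S (D k) * \<delta> (n k) = (1 - inverse (real r ^ D k)) / (real r - 1) *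
      ((ratio (n k) - \<beta> * ratio (Suc (n k))) * \<beta> powr (real (n k) - \<nu> r p (D k)))" for k
  proof -
    have "\<delta> (n k) = (ratio (n k) - \<beta> * ratio (Suc (n k))) * \<beta> ^ n k"
      unfolding \<delta>_eq long by (simp add: left_diff_distrib)
    moreover have "(1 - inverse (real r ^ D k)) * real r ^ D k = real r ^ D k - 1"
      using r_ge_2 by (simp add: left_diff_distrib)
    moreover have "i / q * (t * (x * b)) = i * x / q * (t * b)" for i q t x b :: real
      by simp
    ultimately show ?thesis by (simp only: S_eq power_r_power_\<beta>[symmetric])
  qed
  have "(\<lambda>k. S (D k) * \<delta> (n k)) \<longlonglongrightarrow> (1 - 0) / (real r - 1) * ((c - \<beta> * c) * \<beta> powr y)"
    unfolding Sd using r_ge_2 by (intro tendsto_intros inv r0 r1 pw) auto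
  then have "(\<lambda>k. clumps (n k) (D k)) \<longlonglongrightarrow>
      c * \<beta> powr y + (1 - 0) / (real r - 1) * ((c - \<beta> * c) * \<beta> powr y)"
    unfolding clumps_def by (intro tendsto_add lim)
  also have "c * \<beta> powr y + (1 - 0) / (real r - 1) * ((c - \<beta> * c) * \<beta> powr y) = C * \<beta> powr y"
  proof -
    have "c + (c - \<beta> * c) / (real r - 1) = C"
      using r_ge_2 by (simp add: C_def \<beta>_def field_simps)
    then have "(c + (c - \<beta> * c) / (real r - 1)) * \<beta> powr y = C * \<beta> powr y" by simp
    then show ?thesis by (simp add: left_diff_distrib distrib_right mult.assoc)
  qed
  finally show "(\<lambda>k. clumps (n k) (D k)) \<longlonglongrightarrow> C * \<beta> powr y" .
qed

text \<open>For the lower bound, the linear estimate is sharp up to generation \<open>d - d div 2\<close>, where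
  long runs are still unlikely, and the remaining \<open>d div 2\<close> steps of the recursion
  contribute the power.\<close>

lemma u_tendsto:
  assumes D: "filterlim D at_top sequentially"
    and y: "(\<lambda>k. real (n k) - \<nu> r p (D k)) \<longlonglongrightarrow> y"
    and n: "\<And>k. 0 < n k"
  shows "(\<lambda>k. u (n k) (D k)) \<longlonglongrightarrow> exp (- C * \<beta> powr y)"
proof -
  let ?A = "\<lambda>k. clumps (n k) (D k)" and ?m = "\<lambda>k. D k div 2"
  let ?B = "\<lambda>k. ?A k / real r ^ ?m k" and ?E = "\<lambda>k. real r ^ D k * long (n k) / real r ^ (D k - ?m k)"
  have A: "?A \<longlonglongrightarrow> C * \<beta> powr y" by (rule clumps_tendsto[OF D y])
  have L: "(\<lambda>k. real r ^ D k * long (n k)) \<longlonglongrightarrow> c * \<beta> powr y" by (rule long_tendsto[OF D y])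
  have half: "filterlim ?m at_top sequentially"
    by (intro filterlim_compose[OF _ D] filterlim_at_top_div_const_nat) auto
  have half': "filterlim (\<lambda>k. D k - ?m k) at_top sequentially"
    by (rule filterlim_at_top_mono[OF half]) (auto intro!: always_eventually)
  have pow: "filterlim (\<lambda>k. real r ^ g k) at_infinity sequentially"
    if "filterlim g at_top sequentially" for g
    using r_ge_2 by (intro filterlim_compose[OF _ that] filterlim_realpow_sequentially_gt1) auto
  have B: "?B \<longlonglongrightarrow> 0" by (intro tendsto_divide_0[OF A] pow half)
  have E: "?E \<longlonglongrightarrow> 0" by (intro tendsto_divide_0[OF L] pow half')
  have "(\<lambda>k. exp (- (?A k / (1 - ?B k))) - ?E k) \<longlonglongrightarrow> exp (- (C * \<beta> powr y / (1 - 0))) - 0"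
    by (intro tendsto_intros A B E) auto
  then have lower: "(\<lambda>k. exp (- (?A k / (1 - ?B k))) - ?E k) \<longlonglongrightarrow> exp (- C * \<beta> powr y)" by simp
  have "(\<lambda>k. exp (- ?A k)) \<longlonglongrightarrow> exp (- (C * \<beta> powr y))" by (intro tendsto_intros A)
  then have upper: "(\<lambda>k. exp (- ?A k)) \<longlonglongrightarrow> exp (- C * \<beta> powr y)" by simp
  show ?thesis
  proof (rule tendsto_sandwich[OF _ _ lower upper])
    have "\<forall>\<^sub>F k in sequentially. ?B k < 1" using order_tendstoD(2)[OF B] by simp
    then show "\<forall>\<^sub>F k in sequentially. exp (- (?A k / (1 - ?B k))) - ?E k \<le> u (n k) (D k)"
      by eventually_elim (intro u_ge_exp_clumps n, auto)
    show "\<forall>\<^sub>F k in sequentially. u (n k) (D k) \<le> exp (- ?A k)"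
      unfolding clumps_def using u_le_exp[OF n] by simp
  qed
qed

section \<open>The Gumbel law and its discretisations\<close>

definition Gumbel :: "real measure" where "Gumbel = interval_measure (\<lambda>z. exp (- C * \<beta> powr z))"

lemma \<beta>_powr_strict_anti: "x < y \<Longrightarrow> \<beta> powr y < \<beta> powr x"
  using \<beta>_pos \<beta>_less_1 by (simp add: powr_less_mono')

lemma exp_neg_\<beta>_powr_tendsto_0:
  assumes "0 < t"
  shows "((\<lambda>z. exp (- t * \<beta> powr z)) \<longlongrightarrow> 0) at_bot"
proof -
  have "filterlim (\<lambda>z. - t * \<beta> powr z) at_bot at_bot"
    using assms powr_at_top_at_bot[OF \<beta>_pos \<beta>_less_1]
    by (intro filterlim_tendsto_neg_mult_at_bot[OF tendsto_const]) auto
  then show ?thesis by (rule filterlim_compose[OF exp_at_bot])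
qed

text \<open>As \<open>\<beta> powr z = exp (- z * ln (1 / \<beta>))\<close>, this is a Gumbel law of
  scale \<open>1 / ln (1 / \<beta>)\<close>.\<close>

lemma
  shows real_distribution_Gumbel: "real_distribution Gumbel"
    and cdf_Gumbel: "cdf Gumbel z = exp (- C * \<beta> powr z)"
proof -
  let ?F = "\<lambda>z. exp (- C * \<beta> powr z)"
  have mono: "?F x \<le> ?F y" if "x \<le> y" for x y
    using that C_pos \<beta>_powr_strict_anti[of x y] by (cases "x = y") auto
  have "isCont ?F a" for a using \<beta>_pos by (intro continuous_intros) auto
  then have cont: "continuous (at_right a) ?F" for a
    using continuous_at_imp_continuous_at_within by blast
  have bot: "(?F \<longlongrightarrow> 0) at_bot" by (rule exp_neg_\<beta>_powr_tendsto_0[OF C_pos])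
  have "(?F \<longlongrightarrow> exp (- C * 0)) at_top"
    by (intro tendsto_intros powr_tendsto_0_at_top \<beta>_pos \<beta>_less_1)
  then have top: "(?F \<longlongrightarrow> 1) at_top" by simp
  show "real_distribution Gumbel"
    unfolding Gumbel_def by (rule real_distribution_interval_measure[OF mono cont bot top])
  show "cdf Gumbel z = ?F z"
    unfolding Gumbel_def by (subst cdf_interval_measure[OF mono cont bot]) auto
qed

definition limit_law :: "real \<Rightarrow> real measure" where
  "limit_law a = distr Gumbel borel (\<lambda>z. of_int \<lfloor>z + a\<rfloor> - a)"

lemma real_distribution_limit_law: "real_distribution (limit_law a)"
proof -
  interpret G: real_distribution Gumbel by (rule real_distribution_Gumbel)
  show ?thesis unfolding limit_law_def by (intro G.real_distribution_distr) simp
qed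

lemma measure_limit_law:
  assumes "A \<in> sets borel"
  shows "measure (limit_law a) A = measure Gumbel {z. of_int \<lfloor>z + a\<rfloor> - a \<in> A}"
proof -
  interpret G: real_distribution Gumbel by (rule real_distribution_Gumbel)
  show ?thesis
    unfolding limit_law_def using assms by (subst measure_distr) (auto simp: vimage_def)
qed

lemma cdf_limit_law: "cdf (limit_law a) x = exp (- C * \<beta> powr (of_int \<lfloor>x + a\<rfloor> + 1 - a))"
proof -
  interpret G: real_distribution Gumbel by (rule real_distribution_Gumbel)
  let ?t = "of_int \<lfloor>x + a\<rfloor> + 1 - a :: real"
  \<comment> \<open>The event is the open half-line below \<open>?t\<close>, whereas
    \<open>cdf\<close> measures closed ones; continuity removes the endpoint.\<close>
  have "isCont (cdf Gumbel) ?t"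
    unfolding cdf_Gumbel[abs_def] using \<beta>_pos by (intro continuous_intros) auto
  then have "measure Gumbel {?t} = 0" by (simp add: G.isCont_cdf)
  then have "measure Gumbel {..<?t} = cdf Gumbel ?t"
    using G.finite_measure_Union[of "{..<?t}" "{?t}"] ivl_disj_un(2)[of ?t] by (simp add: cdf_def)
  moreover have "of_int \<lfloor>z + a\<rfloor> - a \<le> x \<longleftrightarrow> z < ?t" for z
  proof -
    have "of_int \<lfloor>z + a\<rfloor> - a \<le> x \<longleftrightarrow> of_int \<lfloor>z + a\<rfloor> \<le> x + a" by auto
    also have "\<dots> \<longleftrightarrow> \<lfloor>z + a\<rfloor> \<le> \<lfloor>x + a\<rfloor>" by (simp add: le_floor_iff)
    also have "\<dots> \<longleftrightarrow> z < ?t" by (simp add: floor_le_iff algebra_simps)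
    finally show ?thesis .
  qed
  then have "{z. of_int \<lfloor>z + a\<rfloor> - a \<in> {..x}} = {..<?t}" by auto
  ultimately show ?thesis
    unfolding cdf_def[of "limit_law a"] by (simp add: measure_limit_law cdf_Gumbel)
qed

text \<open>A lattice point \<open>x\<close> receives the Gumbel mass of the unit interval starting
  at \<open>x\<close>, whose left half already has positive mass. Other points are outside the
  range.\<close>

lemma limit_law_atom_iff: "measure (limit_law a) {x} = 0 \<longleftrightarrow> x + a \<notin> \<int>"
proof -
  interpret G: real_distribution Gumbel by (rule real_distribution_Gumbel)
  show ?thesis
  proof (cases "x + a \<in> \<int>")
    case True
    then obtain j where j: "x + a = of_int j" by (elim Ints_cases)
    then have x: "x = of_int j - a" by simp
    have "0 < exp (- C * \<beta> powr (x + 1 / 2)) - exp (- C * \<beta> powr x)"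
      using C_pos \<beta>_powr_strict_anti[of x "x + 1 / 2"] by simp
    also have "\<dots> = measure Gumbel {x<..x + 1 / 2}"
      by (subst G.cdf_diff_eq[symmetric]) (auto simp: cdf_Gumbel)
    also have "\<dots> \<le> measure Gumbel {z. of_int \<lfloor>z + a\<rfloor> - a \<in> {x}}"
    proof (intro G.finite_measure_mono subsetI CollectI)
      fix z assume "z \<in> {x<..x + 1 / 2}"
      then have "\<lfloor>z + a\<rfloor> = j" unfolding x by (intro floor_unique) auto
      then show "of_int \<lfloor>z + a\<rfloor> - a \<in> {x}" by (simp add: x)
    next
      have "{z. of_int \<lfloor>z + a\<rfloor> - a \<in> {x}} \<in> sets borel" by measurable
      then show "{z. of_int \<lfloor>z + a\<rfloor> - a \<in> {x}} \<in> sets Gumbel" by simp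
    qed
    finally show ?thesis using True by (simp add: measure_limit_law)
  next
    case False
    then have "{z. of_int \<lfloor>z + a\<rfloor> - a \<in> {x}} = {}" by auto
    then show ?thesis using False by (simp add: measure_limit_law)
  qed
qed

text \<open>The point \<open>- a\<close> is an atom of \<open>limit_law a\<close>, hence of
  \<open>limit_law b\<close>.\<close>

lemma limit_law_eq_imp: "limit_law a = limit_law b \<Longrightarrow> b - a \<in> \<int>"
  using limit_law_atom_iff[of a "- a"] limit_law_atom_iff[of b "- a"] by simp

end

section \<open>Convergence of the longest open run\<close>

context bernoulli_tree
begin

section \<open>Tail bounds uniform in the generation, and tightness\<close>

lemma measurable_centred [measurable]: "(\<lambda>\<omega>. real (R r X d \<omega>) - \<nu> r p d) \<in> borel_measurable M"
proof -
  have "(\<lambda>\<omega>. real (R r X d \<omega>)) \<in> borel_measurable M"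
    by (rule measurable_compose[OF measurable_R]) simp
  then show ?thesis by measurable
qed

lemma real_distribution_centred_law: "real_distribution (centred_law M r p X d)"
  unfolding centred_law_def by (rule real_distribution_distr) simp

lemma cdf_centred_law:
  "cdf (centred_law M r p X d) x = prob {\<omega>\<in>space M. real (R r X d \<omega>) - \<nu> r p d \<le> x}"
  unfolding cdf_def centred_law_def
  by (subst measure_distr) (auto intro!: arg_cong[of _ _ prob])

lemma cdf_centred_law_eq:
  assumes "0 \<le> x + \<nu> r p d"
  shows "cdf (centred_law M r p X d) x = u (Suc (nat \<lfloor>x + \<nu> r p d\<rfloor>)) d"
proof -
  have "{\<omega>\<in>space M. real (R r X d \<omega>) - \<nu> r p d \<le> x} =
      {\<omega>\<in>space M. R r X d \<omega> < Suc (nat \<lfloor>x + \<nu> r p d\<rfloor>)}"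
    unfolding real_le_iff_less_Suc_floor[OF assms, symmetric] by auto
  then show ?thesis by (simp only: cdf_centred_law prob_R_less[OF zero_less_Suc])
qed

text \<open>The centring cancels \<open>r ^ d\<close>, so the bound is uniform in \<open>d\<close>.
  For \<open>x + \<nu> r p d < 0\<close> its left side is negative.\<close>

lemma cdf_centred_law_ge: "1 - 2 * \<beta> powr x \<le> cdf (centred_law M r p X d) x"
proof (cases "0 \<le> x + \<nu> r p d")
  case True
  define n where "n = Suc (nat \<lfloor>x + \<nu> r p d\<rfloor>)"
  have "x + \<nu> r p d \<le> real n" using True unfolding n_def by linarith
  then have "\<beta> powr (real n - \<nu> r p d) \<le> \<beta> powr x"
    using \<beta>_pos \<beta>_less_1 by (intro powr_mono') auto
  moreover have "real r ^ d * long n \<le> real r ^ d * \<beta> ^ n"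
    by (intro mult_left_mono long_le_power) auto
  moreover have "1 - 2 * real r ^ d * long n \<le> u n d" by (rule u_ge) (simp add: n_def)
  moreover have "cdf (centred_law M r p X d) x = u n d"
    using cdf_centred_law_eq[OF True] by (simp add: n_def)
  ultimately show ?thesis unfolding power_r_power_\<beta> by linarith
next
  case False
  then have "\<beta> powr 0 \<le> \<beta> powr x"
    using \<beta>_pos \<beta>_less_1 \<nu>_nonneg[of d] by (intro powr_mono') auto
  then have "1 - 2 * \<beta> powr x \<le> 0" using \<beta>_pos by simp
  then show ?thesis by (rule order_trans) (simp add: cdf_centred_law)
qed

text \<open>Only the term \<open>r ^ d * long n\<close> of the exponent is kept. Rounding the length
  up by at most 1 costs the factor \<open>\<beta>\<close>.\<close>

lemma cdf_centred_law_le: "cdf (centred_law M r p X d) x \<le> exp (- (c * \<beta>) * \<beta> powr x)"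
proof (cases "0 \<le> x + \<nu> r p d")
  case True
  define n where "n = Suc (nat \<lfloor>x + \<nu> r p d\<rfloor>)"
  have "real n \<le> x + \<nu> r p d + 1" using True unfolding n_def by linarith
  then have "\<beta> powr (x + 1) \<le> \<beta> powr (real n - \<nu> r p d)"
    using \<beta>_pos \<beta>_less_1 by (intro powr_mono') auto
  then have "c * \<beta> powr (x + 1) \<le> c * (real r ^ d * \<beta> ^ n)"
    using c_pos by (simp add: power_r_power_\<beta>)
  also have "\<dots> \<le> real r ^ d * long n"
    using mult_left_mono[OF long_ge_power, of "real r ^ d" n] by (simp add: mult_ac)
  also have "\<dots> \<le> real r ^ d * long n + S d * \<delta> n" using S_nonneg \<delta>_nonneg by simp
  finally have "- (real r ^ d * long n + S d * \<delta> n) \<le> - (c * \<beta>) * \<beta> powr x"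
    using \<beta>_pos by (simp add: powr_add mult_ac)
  then show ?thesis
    using u_le_exp[of n d] cdf_centred_law_eq[OF True] unfolding n_def
    by (smt (verit) exp_le_cancel_iff zero_less_Suc)
next
  case False
  then have "{\<omega>\<in>space M. real (R r X d \<omega>) - \<nu> r p d \<le> x} = {}"
    by (auto simp: not_le)
  then show ?thesis unfolding cdf_centred_law by (simp only: measure_empty) simp
qed

lemma tight_centred_law: "tight (centred_law M r p X)"
  unfolding tight_def
proof (intro conjI allI impI)
  show "real_distribution (centred_law M r p X d)" for d by (rule real_distribution_centred_law)
next
  fix \<epsilon> :: real assume \<epsilon>: "0 < \<epsilon>"
  have "\<forall>\<^sub>F b in at_top. \<beta> powr b < \<epsilon> / 4"
    using order_tendstoD(2)[OF powr_tendsto_0_at_top[OF \<beta>_pos \<beta>_less_1], of "\<epsilon> / 4"] \<epsilon> by simp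
  then have "\<forall>\<^sub>F b in at_top. \<beta> powr b < \<epsilon> / 4 \<and> 0 < b"
    using eventually_gt_at_top[of 0] by eventually_elim simp
  then obtain b where b: "\<beta> powr b < \<epsilon> / 4" "0 < b"
    using eventually_happens'[OF trivial_limit_at_top_linorder] by blast
  have "\<forall>\<^sub>F a in at_bot. exp (- (c * \<beta>) * \<beta> powr a) < \<epsilon> / 2"
    using order_tendstoD(2)[OF exp_neg_\<beta>_powr_tendsto_0[of "c * \<beta>"], of "\<epsilon> / 2"] \<epsilon> c_pos \<beta>_pos
    by simp
  then have "\<forall>\<^sub>F a in at_bot. exp (- (c * \<beta>) * \<beta> powr a) < \<epsilon> / 2 \<and> a < 0"
    using eventually_gt_at_bot[of 0] by eventually_elim simp
  then obtain a where a: "exp (- (c * \<beta>) * \<beta> powr a) < \<epsilon> / 2" "a < 0"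
    using eventually_happens'[OF trivial_limit_at_bot_linorder] by blast
  have "1 - \<epsilon> < measure (centred_law M r p X d) {a<..b}" for d
  proof -
    interpret L: real_distribution "centred_law M r p X d" by (rule real_distribution_centred_law)
    have "measure (centred_law M r p X d) {a<..b} =
        cdf (centred_law M r p X d) b - cdf (centred_law M r p X d) a"
      using a b by (subst L.cdf_diff_eq) auto
    then show ?thesis using cdf_centred_law_ge[of b d] cdf_centred_law_le[of d a] a b by linarith
  qed
  then show "\<exists>a b. a < b \<and> (\<forall>d. 1 - \<epsilon> < measure (centred_law M r p X d) {a<..b})"
    using a b by (intro exI[of _ a] exI[of _ b]) auto
qed

text \<open>Both tails at distance \<open>e * d\<close> are of order \<open>q ^ d\<close> with
  \<open>q = \<beta> powr e < 1\<close>, so the Borel-Cantelli lemma applies.\<close>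

lemma AE_eventually_close:
  assumes e: "0 < e"
  shows "AE \<omega> in M. \<forall>\<^sub>F d in sequentially. \<bar>real (R r X d \<omega>) - \<nu> r p d\<bar> \<le> e * real d"
proof -
  define q where "q = \<beta> powr e"
  have q: "0 < q" "q < 1"
    using e \<beta>_pos \<beta>_powr_strict_anti[of 0 e] by (auto simp: q_def)
  have qd: "\<beta> powr (e * real d) = q ^ d" for d
    using q by (simp add: q_def powr_powr flip: powr_realpow)
  let ?Y = "\<lambda>d \<omega>. real (R r X d \<omega>) - \<nu> r p d"
  let ?H = "\<lambda>d. {\<omega>\<in>space M. e * real d < ?Y d \<omega>}"
  let ?L = "\<lambda>d. {\<omega>\<in>space M. ?Y d \<omega> \<le> - (e * real d)}"
  have H: "prob (?H d) \<le> 2 * q ^ d" for d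
  proof -
    have "prob (?H d) = prob (space M - {\<omega>\<in>space M. ?Y d \<omega> \<le> e * real d})"
      by (intro arg_cong[of _ _ prob]) auto
    also have "\<dots> = 1 - cdf (centred_law M r p X d) (e * real d)"
      unfolding cdf_centred_law by (intro prob_compl) simp
    also have "\<dots> \<le> 2 * q ^ d" using cdf_centred_law_ge[of "e * real d" d] by (simp add: qd)
    finally show ?thesis .
  qed
  have L: "prob (?L d) \<le> 1 / (c * \<beta>) * q ^ d" for d
  proof -
    have "prob (?L d) \<le> exp (- (c * \<beta>) * \<beta> powr (- (e * real d)))"
      using cdf_centred_law_le[of d "- (e * real d)"] by (simp add: cdf_centred_law)
    also have "\<dots> = inverse (exp (c * \<beta> / q ^ d))"
      by (simp add: powr_minus qd exp_minus divide_inverse)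
    \<comment> \<open>The doubly exponential tail is weakened to a geometric one by
      \<open>t \<le> exp t\<close>.\<close>
    also have "\<dots> \<le> inverse (c * \<beta> / q ^ d)"
    proof (rule le_imp_inverse_le)
      show "c * \<beta> / q ^ d \<le> exp (c * \<beta> / q ^ d)"
        using exp_ge_add_one_self[of "c * \<beta> / q ^ d"] by linarith
      show "0 < c * \<beta> / q ^ d" using c_pos \<beta>_pos q by simp
    qed
    finally show ?thesis by simp
  qed
  have "summable (\<lambda>d. prob (?H d \<union> ?L d))"
  proof (rule summable_comparison_test')
    show "summable (\<lambda>d. (2 + 1 / (c * \<beta>)) * q ^ d)"
      using q by (intro summable_mult summable_geometric) auto
    show "norm (prob (?H d \<union> ?L d)) \<le> (2 + 1 / (c * \<beta>)) * q ^ d" for d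
      using measure_Un_le[of "?H d" M "?L d"] H[of d] L[of d] by (simp add: distrib_right)
  qed
  then have "AE \<omega> in M. \<forall>\<^sub>F d in sequentially. \<omega> \<in> space M - (?H d \<union> ?L d)"
    by (intro borel_cantelli_AE1) (auto simp: emeasure_eq_measure)
  then show ?thesis
    by eventually_elim (auto elim!: eventually_mono)
qed

lemma AE_tendsto: "AE \<omega> in M. (\<lambda>d. real (R r X d \<omega>) / real d) \<longlonglongrightarrow> \<kappa>"
proof -
  have "AE \<omega> in M. \<forall>k. \<forall>\<^sub>F d in sequentially.
      \<bar>real (R r X d \<omega>) - \<nu> r p d\<bar> \<le> inverse (real (Suc k)) * real d"
    unfolding AE_all_countable using AE_eventually_close by simp
  then show ?thesis
  proof eventually_elim
    case (elim \<omega>)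
    show ?case
    proof (rule tendstoI)
      fix e :: real assume "0 < e"
      then obtain k where k: "inverse (real (Suc k)) < e" using reals_Archimedean by blast
      show "\<forall>\<^sub>F d in sequentially. dist (real (R r X d \<omega>) / real d) \<kappa> < e"
        using elim[rule_format, of k] eventually_gt_at_top[of 0]
      proof eventually_elim
        case (elim d)
        then have "\<bar>real (R r X d \<omega>) / real d - \<kappa>\<bar> \<le> inverse (real (Suc k))"
          using abs_divide[of "real (R r X d \<omega>) - \<nu> r p d" "real d"]
          by (simp add: \<nu>_eq diff_divide_distrib pos_divide_le_eq)
        then show ?case using k by (simp add: dist_real_def)
      qed
    qed
  qed
qed

text \<open>At a continuity point \<open>x + a\<close> is not an integer, so rounding is eventually
  stable. The relevant integer length minus its centring then converges to the argument found in
  \<open>cdf_limit_law\<close>, and \<open>u_tendsto\<close> applies.\<close>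

lemma weak_conv_limit_law:
  assumes s: "filterlim s at_top sequentially" and a: "tends_mod1 (\<lambda>k. frac (\<nu> r p (s k))) a"
  shows "weak_conv_m (\<lambda>k. centred_law M r p X (s k)) (limit_law a)"
  unfolding weak_conv_m_def weak_conv_def
proof (intro allI impI)
  fix x assume cont: "isCont (cdf (limit_law a)) x"
  interpret L: real_distribution "limit_law a" by (rule real_distribution_limit_law)
  have xa: "x + a \<notin> \<int>" using cont by (simp add: L.isCont_cdf limit_law_atom_iff)
  obtain m0 :: "nat \<Rightarrow> int" where m0: "(\<lambda>k. frac (\<nu> r p (s k)) - of_int (m0 k)) \<longlonglongrightarrow> a"
    using a unfolding tends_mod1_def by blast
  \<comment> \<open>This collects both integer corrections, so that \<open>\<nu> r p (s k)\<close>
    itself, not its fractional part, is compared with \<open>a\<close>.\<close>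
  define m where "m k = \<lfloor>\<nu> r p (s k)\<rfloor> + m0 k" for k
  have m: "(\<lambda>k. \<nu> r p (s k) - of_int (m k)) \<longlonglongrightarrow> a"
    using m0 by (simp add: m_def frac_def algebra_simps)
  have "(\<lambda>k. x + (\<nu> r p (s k) - of_int (m k))) \<longlonglongrightarrow> x + a" by (intro tendsto_intros m)
  from eventually_floor_eq[OF this xa]
  have fl: "\<forall>\<^sub>F k in sequentially. \<lfloor>x + \<nu> r p (s k)\<rfloor> = \<lfloor>x + a\<rfloor> + m k"
  proof eventually_elim
    case (elim k)
    have "\<lfloor>x + (\<nu> r p (s k) - of_int (m k))\<rfloor> = \<lfloor>x + \<nu> r p (s k)\<rfloor> - m k"
      by (simp only: add_diff_eq floor_diff_of_int)
    then show ?case using elim by simp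
  qed
  define n where "n k = Suc (nat \<lfloor>x + \<nu> r p (s k)\<rfloor>)" for k
  have "filterlim (\<lambda>k. x + \<nu> r p (s k)) at_top sequentially"
    by (intro filterlim_tendsto_add_at_top[OF tendsto_const] filterlim_compose[OF \<nu>_at_top s])
  then have pos: "\<forall>\<^sub>F k in sequentially. 0 \<le> x + \<nu> r p (s k)"
    by (simp add: filterlim_at_top)
  have "\<forall>\<^sub>F k in sequentially. of_int \<lfloor>x + a\<rfloor> + 1 - (\<nu> r p (s k) - of_int (m k)) =
      real (n k) - \<nu> r p (s k)"
    using fl pos
  proof eventually_elim
    case (elim k)
    have "real (n k) = of_int \<lfloor>x + \<nu> r p (s k)\<rfloor> + 1" using elim(2) by (simp add: n_def)
    then show ?case using elim(1) by simp
  qed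
  moreover have "(\<lambda>k. of_int \<lfloor>x + a\<rfloor> + 1 - (\<nu> r p (s k) - of_int (m k))) \<longlonglongrightarrow> of_int \<lfloor>x + a\<rfloor> + 1 - a"
    by (intro tendsto_intros m)
  ultimately have "(\<lambda>k. real (n k) - \<nu> r p (s k)) \<longlonglongrightarrow> of_int \<lfloor>x + a\<rfloor> + 1 - a"
    by (rule Lim_transform_eventually[rotated])
  then have "(\<lambda>k. u (n k) (s k)) \<longlonglongrightarrow> cdf (limit_law a) x"
    unfolding cdf_limit_law by (rule u_tendsto[OF s]) (simp add: n_def)
  then show "(\<lambda>k. cdf (centred_law M r p X (s k)) x) \<longlonglongrightarrow> cdf (limit_law a) x"
    by (rule Lim_transform_eventually)
      (use pos in eventually_elim, simp add: cdf_centred_law_eq n_def)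
qed

text \<open>By compactness every subsequence has a further one along which the fractional parts tend
  to some \<open>b\<close>, and then the weak limit is \<open>limit_law b\<close>. Its atoms
  determine \<open>b\<close> modulo 1, so all these limits coincide on the circle.\<close>

lemma converges_weakly_imp_tends_mod1:
  assumes s: "strict_mono s" and "converges_weakly (\<lambda>k. centred_law M r p X (s k))"
  shows "\<exists>a. tends_mod1 (\<lambda>k. frac (\<nu> r p (s k))) a"
proof -
  obtain L where L: "real_distribution L" and wL: "weak_conv_m (\<lambda>k. centred_law M r p X (s k)) L"
    using assms(2) unfolding converges_weakly_def by blast
  define f where "f k = frac (\<nu> r p (s k))" for k
  have f01: "f k \<in> {0..1}" for k using frac_lt_1[of "\<nu> r p (s k)"] by (simp add: f_def)
  have sub: "\<exists>b t'. strict_mono t' \<and> (f \<circ> t \<circ> t') \<longlonglongrightarrow> b \<and> L = limit_law b"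
    if t: "strict_mono t" for t :: "nat \<Rightarrow> nat"
  proof -
    obtain b t' where t': "strict_mono (t' :: nat \<Rightarrow> nat)" "(f \<circ> t \<circ> t') \<longlonglongrightarrow> b"
      using compact_imp_seq_compact[OF compact_Icc[of 0 "1::real"]] f01
      unfolding seq_compact_def by (metis comp_apply)
    define s' where "s' = s \<circ> t \<circ> t'"
    have tt: "strict_mono (t \<circ> t')" by (rule strict_mono_o[OF t t'(1)])
    have s': "filterlim s' at_top sequentially"
      unfolding s'_def comp_assoc using strict_mono_o[OF s tt] by (rule filterlim_subseq)
    have "tends_mod1 (\<lambda>k. frac (\<nu> r p (s' k))) b"
      using t'(2) by (intro tends_mod1_LIMSEQ) (simp add: f_def s'_def comp_def)
    then have wb: "weak_conv_m (\<lambda>k. centred_law M r p X (s' k)) (limit_law b)"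
      by (rule weak_conv_limit_law[OF s'])
    have "weak_conv_m (\<lambda>k. centred_law M r p X (s' k)) L"
      unfolding weak_conv_m_def weak_conv_def
    proof (intro allI impI)
      fix x assume "isCont (cdf L) x"
      then have "(\<lambda>k. cdf (centred_law M r p X (s k)) x) \<longlonglongrightarrow> cdf L x"
        using wL unfolding weak_conv_m_def weak_conv_def by blast
      from LIMSEQ_subseq_LIMSEQ[OF this tt]
      show "(\<lambda>k. cdf (centred_law M r p X (s' k)) x) \<longlonglongrightarrow> cdf L x"
        by (simp add: s'_def comp_def)
    qed
    then have "char L = char (limit_law b)"
      using wb real_distribution_centred_law L real_distribution_limit_law
      by (intro ext LIMSEQ_unique[OF levy_continuity1 levy_continuity1]) auto
    then have "L = limit_law b" by (rule Levy_uniqueness[OF L real_distribution_limit_law])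
    then show ?thesis using t' by blast
  qed
  obtain a where a: "L = limit_law a" using sub[OF strict_mono_id] by blast
  \<comment> \<open>Subtracting the integer nearest to \<open>f k - a\<close> leaves the distance to
    \<open>a\<close> on the circle as error.\<close>
  have "(\<lambda>k. f k - of_int (round (f k - a))) \<longlonglongrightarrow> a"
  proof (rule ccontr)
    assume "\<not> ?thesis"
    then obtain e where e: "0 < e" 
      "\<not> (\<forall>\<^sub>F k in sequentially. dist (f k - of_int (round (f k - a))) a < e)"
      unfolding tendsto_iff by blast
    then have "\<exists>\<^sub>F k in sequentially. e \<le> dist (f k - of_int (round (f k - a))) a"
      by (simp add: not_eventually not_less)
    then have "infinite {k. e \<le> dist (f k - of_int (round (f k - a))) a}"
      by (simp add: INFM_iff_infinite flip: cofinite_eq_sequentially)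
    from infinite_enumerate[OF this]
    obtain t :: "nat \<Rightarrow> nat" where t: "strict_mono t"
      "\<And>k. e \<le> dist (f (t k) - of_int (round (f (t k) - a))) a" by auto
    obtain b t' where t': "strict_mono t'" "(f \<circ> t \<circ> t') \<longlonglongrightarrow> b" "L = limit_law b"
      using sub[OF t(1)] by blast
    have "b - a \<in> \<int>" using a t'(3) by (intro limit_law_eq_imp) simp
    then obtain j where j: "b = a + of_int j" by (elim Ints_cases) (simp add: algebra_simps)
    have "\<forall>\<^sub>F k in sequentially. dist (f (t (t' k))) b < e"
      using tendstoD[OF t'(2) e(1)] by simp
    then obtain k where k: "dist (f (t (t' k))) b < e" using eventually_happens by force
    \<comment> \<open>The nearest integer does at least as well as \<open>j = b - a\<close>,
      contrary to the choice of \<open>t\<close>.\<close>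
    have "\<bar>f (t (t' k)) - a - of_int (round (f (t (t' k)) - a))\<bar> \<le> \<bar>f (t (t' k)) - a - of_int j\<bar>"
      by (rule round_diff_minimal)
    then show False using t(2)[of "t' k"] k by (simp add: dist_real_def j algebra_simps)
  qed
  then show ?thesis
    unfolding tends_mod1_def f_def by (intro exI[of _ a] exI[of _ "\<lambda>k. round (frac (\<nu> r p (s k)) - a)"])
qed

end

theorem theorem4:
  fixes r :: nat and p :: real
  assumes "2 \<le> r" and "0 < p" and "p < 1 / real r"
  shows "\<exists>C>0. \<exists>N. real_distribution N \<and>
    (\<forall>z. cdf N z = exp (- C * (real r * p) powr z)) \<and>
    (\<forall>(M :: 'a measure) X. iid_bernoulli M r p X \<longrightarrow>
       (AE \<omega> in M. (\<lambda>d. real (R r X d \<omega>) / real d) \<longlonglongrightarrow> 1 / (log (real r) (1 / p) - 1)) \<and>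
       tight (centred_law M r p X) \<and>
       (\<forall>s. strict_mono s \<longrightarrow>
          (converges_weakly (\<lambda>k. centred_law M r p X (s k)) \<longleftrightarrow>
             (\<exists>a. tends_mod1 (\<lambda>k. frac (\<nu> r p (s k))) a)) \<and>
          (\<forall>a. tends_mod1 (\<lambda>k. frac (\<nu> r p (s k))) a \<longrightarrow>
             weak_conv_m (\<lambda>k. centred_law M r p X (s k))
               (distr N borel (\<lambda>z. of_int \<lfloor>z + a\<rfloor> - a)))))"
proof -
  interpret subcritical r p using assms by unfold_locales
  show ?thesis
  \<comment> \<open>\<open>C\<close> and \<open>Gumbel\<close> are built from \<open>r\<close> and
    \<open>p\<close> alone, so they can be fixed before the probability space and the family
    \<open>X\<close>.\<close>
  proof (rule exI[of _ C], intro conjI exI[of _ Gumbel] allI impI)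
    show "0 < C" by (rule C_pos)
    show "real_distribution Gumbel" by (rule real_distribution_Gumbel)
    show "cdf Gumbel z = exp (- C * (real r * p) powr z)" for z
      using cdf_Gumbel by (simp add: \<beta>_def)
  next
    fix M :: "'a measure" and X assume X: "iid_bernoulli M r p X"
    then interpret bernoulli_tree r p M X
      using bernoulli_tree_iff[OF subcritical_axioms] by blast
    show "AE \<omega> in M. (\<lambda>d. real (R r X d \<omega>) / real d) \<longlonglongrightarrow> 1 / (log (real r) (1 / p) - 1)"
      using AE_tendsto by (simp add: \<kappa>_def)
    show "tight (centred_law M r p X)" by (rule tight_centred_law)
    fix s :: "nat \<Rightarrow> nat" assume s: "strict_mono s"
    show weak: "weak_conv_m (\<lambda>k. centred_law M r p X (s k))
        (distr Gumbel borel (\<lambda>z. of_int \<lfloor>z + a\<rfloor> - a))"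
      if "tends_mod1 (\<lambda>k. frac (\<nu> r p (s k))) a" for a
      using weak_conv_limit_law[OF filterlim_subseq[OF s] that] by (simp add: limit_law_def)
    show "converges_weakly (\<lambda>k. centred_law M r p X (s k)) \<longleftrightarrow>
        (\<exists>a. tends_mod1 (\<lambda>k. frac (\<nu> r p (s k))) a)"
      using converges_weakly_imp_tends_mod1[OF s] weak real_distribution_limit_law
      unfolding converges_weakly_def limit_law_def by blast
  qed
qed

end
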